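(* Let $(f_w)_{w\in2\mathbb{N},\,w\ge6}$ denote the sequence of normalized extremal quasimodular forms of depth $1$ ($f_w$ of weight $w$). Then $$f_6=\frac1{720}\left(E_2E_4-E_6\right),$$ and for every $w\ge6$ with $w\equiv0\pmod6$, $$f_{w+6}=\frac{w+6}{72(w+1)(w+5)}\left(E_4\partial_{w-1}f_w-\frac{w+1}{12}E_6f_w\right),$$ $$f_{w+2}=\frac{12}{w+1}\partial_{w-1}f_w,\qquad f_{w+4}=E_4f_w.$$
   Context: $\mathcal{M}_k$ is the space of holomorphic modular forms of weight $k$ for $\mathrm{PSL}(2,\mathbb{Z})$; $q=e^{2\pi iz}$; $E_{2k}=1-\frac{4k}{B_{2k}}\sum_{n\ge1}\sigma_{2k-1}(n)q^n$ ($k\ge1$). $f'=\frac1{2\pi i}\frac{df}{dz}$, and $\partial_kf=f'-\frac k{12}E_2f$ is the Serre derivative. $\mathcal{QM}_w^1=\mathcal{M}_w\oplus E_2\mathcal{M}_{w-2}$. A normalized extremal quasimodular form of weight $w$ and depth $1$ is an element of $\mathcal{QM}_w^1$ of vanishing order $\dim\mathcal{QM}_w^1-1=\lfloor w/6\rfloor$ at $i\infty$ (in $q$) with leading coefficient $1$. *)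

theory Defs
  imports "HOL-Complex_Analysis.Complex_Analysis" "HOL-Library.Function_Algebras"
begin

text \<open>
  Functions on the upper half-plane are represented by total functions on the complex numbers
  that vanish outside of it, so that equality of functions and linear (in)dependence have
  their usual meaning.
\<close>

definition upper_half_plane :: "complex set" where
  "upper_half_plane = {z. Im z > 0}"

definition nome :: "complex \<Rightarrow> complex" where
  "nome z = exp (2 * of_real pi * \<i> * z)"

definition has_q_expansion :: "(complex \<Rightarrow> complex) \<Rightarrow> complex fps \<Rightarrow> bool" where
  "has_q_expansion f F \<longleftrightarrow>
     (\<forall>z\<in>upper_half_plane. (\<lambda>n. fps_nth F n * nome z ^ n) sums f z)"

text \<open>
  Holomorphy at the cusp is expressed by a \<open>q\<close>-expansion without negative powers.
  The transformation law ranges over all integer matrices of determinant 1; the matrix \<open>-I\<close>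
  forces forms of odd weight to vanish.
\<close>

definition modular_forms :: "int \<Rightarrow> (complex \<Rightarrow> complex) set" where
  "modular_forms k = {f.
     f holomorphic_on upper_half_plane \<and>
     (\<forall>z. z \<notin> upper_half_plane \<longrightarrow> f z = 0) \<and>
     (\<forall>a b c d :: int. \<forall>z\<in>upper_half_plane. a * d - b * c = 1 \<longrightarrow>
        f ((of_int a * z + of_int b) / (of_int c * z + of_int d)) =
          (of_int c * z + of_int d) powi k * f z) \<and>
     (\<exists>F. has_q_expansion f F)}"

fun bernoulli :: "nat \<Rightarrow> real" where
  "bernoulli 0 = 1"
| "bernoulli (Suc n) =
     - (\<Sum>k\<le>n. real ((n + 2) choose k) * bernoulli k) / real (n + 2)"

definition divisor_sigma :: "nat \<Rightarrow> nat \<Rightarrow> nat" where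
  "divisor_sigma m n = (\<Sum>d | d dvd n. d ^ m)"

text \<open>
  The argument \<open>k\<close> is the weight (even and at least 2), so the usual factor
  \<open>4j/B\<^bsub>2j\<^esub>\<close> reads \<open>2k/B\<^sub>k\<close> with \<open>k = 2j\<close>.
\<close>

definition eisenstein :: "nat \<Rightarrow> complex \<Rightarrow> complex" where
  "eisenstein k z =
     (if z \<in> upper_half_plane then
        1 - of_nat (2 * k) / of_real (bernoulli k) *
          (\<Sum>n. of_nat (divisor_sigma (k - 1) (Suc n)) * nome z ^ Suc n)
      else 0)"

definition normalized_deriv :: "(complex \<Rightarrow> complex) \<Rightarrow> complex \<Rightarrow> complex" where
  "normalized_deriv f z =
     (if z \<in> upper_half_plane then deriv f z / (2 * of_real pi * \<i>) else 0)"

definition serre_deriv :: "int \<Rightarrow> (complex \<Rightarrow> complex) \<Rightarrow> complex \<Rightarrow> complex" where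
  "serre_deriv k f z = normalized_deriv f z - of_int k / 12 * eisenstein 2 z * f z"

definition quasimodular_forms1 :: "int \<Rightarrow> (complex \<Rightarrow> complex) set" where
  "quasimodular_forms1 w =
     {\<lambda>z. A z + eisenstein 2 z * B z |A B. A \<in> modular_forms w \<and> B \<in> modular_forms (w - 2)}"

definition cfun_scale :: "complex \<Rightarrow> (complex \<Rightarrow> complex) \<Rightarrow> complex \<Rightarrow> complex" where
  "cfun_scale c f = (\<lambda>z. c * f z)"

interpretation cfun: vector_space cfun_scale
  by unfold_locales (auto simp: cfun_scale_def fun_eq_iff algebra_simps)

text \<open>
  The leading coefficient being 1 rules out the zero series, whose \<open>subdegree\<close> is 0.
\<close>

definition normalized_extremal1 :: "int \<Rightarrow> (complex \<Rightarrow> complex) \<Rightarrow> bool" where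
  "normalized_extremal1 w f \<longleftrightarrow>
     f \<in> quasimodular_forms1 w \<and>
     (\<exists>F. has_q_expansion f F \<and>
          int (subdegree F) = int (cfun.dim (quasimodular_forms1 w)) - 1 \<and>
          fps_nth F (subdegree F) = 1)"

end

theory Submission
  imports Defs
begin

text \<open>
  An element \<open>f = A + E\<^sub>2 B\<close> of weight \<open>w\<close> and depth 1 yields the modular form
  \<open>f\<^sup>2 + 12 (B' f - B f')\<close> of weight \<open>2 w\<close>. By the valence bound it vanishes as soon as
  \<open>f\<close> vanishes to order greater than \<open>w / 6\<close>, and then so does \<open>f\<close>. Hence extremal forms are unique,
  and each recursion only needs a check of the leading coefficient; the one in weight \<open>w + 6\<close> involves
  the second coefficient of \<open>f\<^sub>w\<close>, which a second-order differential equation provides that is itself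
  an instance of uniqueness.

  The transformation laws of \<open>E\<^sub>2\<close>, \<open>E\<^sub>4\<close>, \<open>E\<^sub>6\<close> are read off together from the Taylor coefficients
  at \<open>u = 0\<close> of one identity relating
  \<open>\<pi> cot (\<pi> u) + 4 \<pi> \<Sum>\<^sub>d sin (2 \<pi> d u) q\<^sup>d / (1 - q\<^sup>d)\<close> for \<open>z\<close> and for \<open>- 1 / z\<close>.
  The valence bound follows from the maximum modulus principle applied to \<open>f\<^sup>1\<^sup>2 / \<Delta>\<^sup>k\<close>.
\<close>

text \<open>The reason behind the combination \<open>f^2 + 12 (B' f - B f')\<close>: divided by
  \<open>f^2\<close> it is \<open>1 + 12 (B / f)'\<close>. If it vanished with \<open>f\<close>
  nonzero, \<open>B / f\<close> would be a Laurent series in \<open>q\<close> with derivative - 1 /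
  12, but \<open>q d/dq\<close> kills constant terms. Its weight \<open>2 w\<close> against the
  bound 12 per order is the source of \<open>w / 6\<close>.

  The order of an extremal form is prescribed through a dimension, so this dimension has to be
  computed too. The upper bound is the vanishing criterion. The lower bound needs a form of each
  order up to \<open>w div 6\<close>, and the recursions themselves supply these, started at the
  constant 1 in weight 0: they serve for existence before they describe the given sequence.

  The Eisenstein series are given by \<open>q\<close>-series, and the lattice sum behind
  \<open>E\<^sub>2\<close> converges only conditionally. A kernel in an extra variable
  \<open>u\<close> avoids lattice sums; the failure of \<open>E\<^sub>2\<close> to be modular is
  then the linear term in \<open>u\<close> that makes up for the quasi-periods.\<close>

subsection \<open>Expansions in the nome\<close>

lemma upper_half_plane_iff: "z \<in> upper_half_plane \<longleftrightarrow> Im z > 0"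
  by (simp add: upper_half_plane_def)

lemma open_upper_half_plane: "open upper_half_plane"
  by (simp add: upper_half_plane_def open_halfspace_Im_gt)

lemma connected_upper_half_plane: "connected upper_half_plane"
  by (simp add: upper_half_plane_def convex_halfspace_Im_gt convex_connected)

lemma norm_nome: "norm (nome z) = exp (- 2 * pi * Im z)"
  by (simp add: nome_def norm_exp_eq_Re)

lemma nome_nonzero [simp]: "nome z \<noteq> 0"
  by (simp add: nome_def)

lemma norm_nome_less_1_iff: "norm (nome z) < 1 \<longleftrightarrow> Im z > 0"
  by (simp add: norm_nome zero_less_mult_iff)

lemma nome_add: "nome (z + w) = nome z * nome w"
  by (simp add: nome_def algebra_simps flip: exp_add)

lemma nome_minus: "nome (- z) = inverse (nome z)"
  by (simp add: nome_def exp_minus)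

lemma nome_0 [simp]: "nome 0 = 1"
  by (simp add: nome_def)

lemma nome_1 [simp]: "nome 1 = 1"
  by (simp add: nome_def mult.commute)

lemma nome_eq_1_iff: "nome z = 1 \<longleftrightarrow> (\<exists>n::int. z = of_int n)"
proof -
  have "nome z = 1 \<longleftrightarrow> Im z = 0 \<and> (\<exists>n::int. Re z = of_int n)"
    by (simp add: nome_def exp_eq_1)
  also have "\<dots> \<longleftrightarrow> (\<exists>n::int. z = of_int n)"
    by (auto simp: complex_eq_iff)
  finally show ?thesis .
qed

lemma nome_surj_disc:
  assumes "x \<noteq> 0" "norm x < 1"
  obtains z where "z \<in> upper_half_plane" "nome z = x"
proof
  let ?z = "Ln x / (2 * of_real pi * \<i>)"
  show "nome ?z = x"
    using assms by (simp add: nome_def)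
  then show "?z \<in> upper_half_plane"
    using assms norm_nome_less_1_iff[of ?z] by (simp add: upper_half_plane_iff)
qed

lemma has_field_derivative_nome [derivative_intros]:
  assumes "(g has_field_derivative g') (at z within A)"
  shows "((\<lambda>z. nome (g z)) has_field_derivative (2 * of_real pi * \<i> * g' * nome (g z))) (at z within A)"
  unfolding nome_def by (auto intro!: derivative_eq_intros assms)

lemma holomorphic_on_nome [holomorphic_intros]:
  "g holomorphic_on A \<Longrightarrow> (\<lambda>z. nome (g z)) holomorphic_on A"
  unfolding nome_def by (intro holomorphic_intros)

text \<open>The nome attains every real number in (0, 1), so pointwise convergence on the half-plane
  forces radius at least 1. This moves all later work to \<open>eval_fps\<close>, where the rules
  for sums, products and derivatives apply.\<close>

lemma has_q_expansion_iff:
  "has_q_expansion f F \<longleftrightarrow>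
     fps_conv_radius F \<ge> 1 \<and> (\<forall>z\<in>upper_half_plane. f z = eval_fps F (nome z))"
proof (intro iffI conjI ballI)
  assume f: "has_q_expansion f F"
  show "fps_conv_radius F \<ge> 1"
    unfolding fps_conv_radius_def
  proof (rule conv_radius_geI_ex')
    fix r :: real assume r: "0 < r" "ereal r < 1"
    then obtain z where "z \<in> upper_half_plane" "nome z = of_real r"
      using nome_surj_disc[of "of_real r"] by auto
    with f show "summable (\<lambda>n. fps_nth F n * of_real r ^ n)"
      by (metis has_q_expansion_def summable_def)
  qed
  fix z assume "z \<in> upper_half_plane"
  with f show "f z = eval_fps F (nome z)"
    by (auto simp: has_q_expansion_def eval_fps_def sums_iff)
next
  assume F: "fps_conv_radius F \<ge> 1 \<and> (\<forall>z\<in>upper_half_plane. f z = eval_fps F (nome z))"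
  show "has_q_expansion f F"
    unfolding has_q_expansion_def
  proof
    fix z assume z: "z \<in> upper_half_plane"
    then have "ereal (norm (nome z)) < 1"
      by (simp add: norm_nome_less_1_iff upper_half_plane_iff)
    with F z sums_eval_fps[of "nome z" F] show "(\<lambda>n. fps_nth F n * nome z ^ n) sums f z"
      by (metis less_le_trans)
  qed
qed

lemma q_expansion_radius_ge_1: "has_q_expansion f F \<Longrightarrow> fps_conv_radius F \<ge> 1"
  by (simp add: has_q_expansion_iff)

lemma q_expansion_radius_pos: "has_q_expansion f F \<Longrightarrow> fps_conv_radius F > 0"
  using q_expansion_radius_ge_1 less_le_trans[of "0::ereal" 1] by simp

lemma q_expansion_radius:
  assumes "has_q_expansion f F" "z \<in> upper_half_plane"
  shows "ereal (norm (nome z)) < fps_conv_radius F"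
proof -
  have "ereal (norm (nome z)) < 1"
    using assms(2) by (simp add: norm_nome_less_1_iff upper_half_plane_iff)
  then show ?thesis
    using q_expansion_radius_ge_1[OF assms(1)] by (rule less_le_trans)
qed

lemma q_expansion_eq:
  "has_q_expansion f F \<Longrightarrow> z \<in> upper_half_plane \<Longrightarrow> f z = eval_fps F (nome z)"
  by (simp add: has_q_expansion_iff)

lemma q_expansion_cong:
  assumes "has_q_expansion f F" "\<And>z. z \<in> upper_half_plane \<Longrightarrow> g z = f z"
  shows "has_q_expansion g F"
  using assms by (simp add: has_q_expansion_def)

lemma q_expansion_const: "has_q_expansion (\<lambda>z. c) (fps_const c)"
  by (simp add: has_q_expansion_iff)

lemma q_expansion_add:
  assumes "has_q_expansion f F" "has_q_expansion g G"
  shows "has_q_expansion (\<lambda>z. f z + g z) (F + G)"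
  unfolding has_q_expansion_iff
proof safe
  show "1 \<le> fps_conv_radius (F + G)"
    using assms by (intro order.trans[OF _ fps_conv_radius_add]) (auto simp: has_q_expansion_iff)
qed (use assms in \<open>simp add: eval_fps_add q_expansion_radius q_expansion_eq\<close>)

lemma q_expansion_mult:
  assumes "has_q_expansion f F" "has_q_expansion g G"
  shows "has_q_expansion (\<lambda>z. f z * g z) (F * G)"
  unfolding has_q_expansion_iff
proof safe
  show "1 \<le> fps_conv_radius (F * G)"
    using assms by (intro order.trans[OF _ fps_conv_radius_mult]) (auto simp: has_q_expansion_iff)
qed (use assms in \<open>simp add: eval_fps_mult q_expansion_radius q_expansion_eq\<close>)

lemma q_expansion_scale:
  "has_q_expansion f F \<Longrightarrow> has_q_expansion (\<lambda>z. c * f z) (fps_const c * F)"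
  by (intro q_expansion_mult q_expansion_const)

lemma q_expansion_diff:
  assumes "has_q_expansion f F" "has_q_expansion g G"
  shows "has_q_expansion (\<lambda>z. f z - g z) (F - G)"
  using q_expansion_add[OF assms(1) q_expansion_scale[OF assms(2), of "-1"]]
  by (simp flip: fps_const_neg)

lemma q_expansion_power:
  "has_q_expansion f F \<Longrightarrow> has_q_expansion (\<lambda>z. f z ^ n) (F ^ n)"
  by (induction n) (use q_expansion_const[of 1] in \<open>auto intro: q_expansion_mult\<close>)

text \<open>The derivative of a \<open>q\<close>-series is stated for an arbitrary radius of convergence: it is
  also needed for series converging at \<open>q = 1\<close>.\<close>

lemma has_field_derivative_eval_fps_nome:
  assumes "ereal (norm (nome z)) < fps_conv_radius F"
  shows "((\<lambda>z. eval_fps F (nome z)) has_field_derivative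
            2 * of_real pi * \<i> * eval_fps (fps_X * fps_deriv F) (nome z)) (at z)"
proof -
  have "((\<lambda>z. eval_fps F (nome z)) has_field_derivative
          eval_fps (fps_deriv F) (nome z) * (2 * of_real pi * \<i> * 1 * nome z)) (at z)"
    by (rule DERIV_chain2[where f = "eval_fps F"])
      (auto intro!: derivative_eq_intros has_field_derivative_eval_fps assms)
  moreover have "eval_fps (fps_X * fps_deriv F) (nome z) = nome z * eval_fps (fps_deriv F) (nome z)"
    using assms fps_conv_radius_deriv[of F] by (subst eval_fps_mult) (auto intro: less_le_trans)
  ultimately show ?thesis
    by (simp add: mult_ac)
qed

lemma q_expansion_has_field_derivative:
  assumes "has_q_expansion f F" "z \<in> upper_half_plane"
  shows "(f has_field_derivative
            2 * of_real pi * \<i> * eval_fps (fps_X * fps_deriv F) (nome z)) (at z)"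
proof (rule DERIV_cong_ev[THEN iffD2])
  show "eventually (\<lambda>z. f z = eval_fps F (nome z)) (nhds z)"
    using eventually_nhds_in_open[OF open_upper_half_plane assms(2)]
    by eventually_elim (use assms in \<open>simp add: q_expansion_eq\<close>)
qed (use assms in \<open>auto intro!: has_field_derivative_eval_fps_nome q_expansion_radius\<close>)

lemma q_expansion_holomorphic:
  "has_q_expansion f F \<Longrightarrow> f holomorphic_on upper_half_plane"
  using q_expansion_has_field_derivative
  by (subst holomorphic_on_open[OF open_upper_half_plane]) blast

lemma q_expansion_deriv:
  assumes "has_q_expansion f F"
  shows "has_q_expansion (normalized_deriv f) (fps_X * fps_deriv F)"
  unfolding has_q_expansion_iff
proof safe
  have "1 \<le> fps_conv_radius F"
    using assms by (simp add: has_q_expansion_iff)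
  then show "1 \<le> fps_conv_radius (fps_X * fps_deriv F)"
    using fps_conv_radius_deriv[of F]
    by (intro order.trans[OF _ fps_conv_radius_mult]) (auto intro: order.trans)
  fix z assume z: "z \<in> upper_half_plane"
  show "normalized_deriv f z = eval_fps (fps_X * fps_deriv F) (nome z)"
    using DERIV_imp_deriv[OF q_expansion_has_field_derivative[OF assms z]] z
    by (simp add: normalized_deriv_def)
qed

lemma q_expansion_periodic:
  assumes "has_q_expansion f F" "z \<in> upper_half_plane"
  shows "f (z + 1) = f z"
  using assms by (simp add: q_expansion_eq upper_half_plane_iff nome_add)

lemma q_expansion_unique:
  assumes "has_q_expansion f F" "has_q_expansion f G"
  shows "F = G"
proof -
  have r: "fps_conv_radius F > 0" "fps_conv_radius G > 0"
    using assms q_expansion_radius_pos by blast+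
  have "eval_fps F x = eval_fps G x" if x: "norm x < 1" "x \<noteq> 0" for x
    using nome_surj_disc[OF x(2,1)] assms by (metis q_expansion_eq)
  then have ev: "eventually (\<lambda>x. eval_fps F x = eval_fps G x) (at 0)"
    unfolding eventually_at by (intro exI[of _ 1]) auto
  \<comment> \<open>The nome omits the value 0, so agreement at the centre of the disc comes from
    continuity.\<close>
  have "(eval_fps F \<longlongrightarrow> eval_fps F 0) (at 0)" "(eval_fps G \<longlongrightarrow> eval_fps G 0) (at 0)"
    using r by (auto simp: zero_ereal_def intro!: continuous_eval_fps[unfolded continuous_within])
  then have "eval_fps F 0 = eval_fps G 0"
    using Lim_transform_eventually[OF _ ev] tendsto_unique[OF trivial_limit_at] by metis
  with ev have "eventually (\<lambda>x. eval_fps F x = eval_fps G x) (nhds 0)"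
    by (auto simp: eventually_at_filter elim: eventually_mono)
  then show ?thesis
    using eval_fps_has_fps_expansion[OF r(1)] eval_fps_has_fps_expansion[OF r(2)]
      has_fps_expansion_cong fps_expansion_unique_complex by metis
qed

lemma q_expansion_eq_0:
  assumes "has_q_expansion f 0" "z \<in> upper_half_plane"
  shows "f z = 0"
  using q_expansion_eq[OF assms] by simp

lemma q_expansion_factor:
  assumes "has_q_expansion f F" "\<And>i. i < n \<Longrightarrow> fps_nth F i = 0"
  obtains g where "has_q_expansion g (fps_shift n F)"
    "\<And>z. z \<in> upper_half_plane \<Longrightarrow> f z = nome z ^ n * g z"
proof
  let ?g = "\<lambda>z. eval_fps (fps_shift n F) (nome z)"
  show g: "has_q_expansion ?g (fps_shift n F)"
    using assms(1) by (simp add: has_q_expansion_iff)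
  fix z assume z: "z \<in> upper_half_plane"
  have F: "F = fps_X ^ n * fps_shift n F"
    using assms(2) by (auto simp: fps_eq_iff fps_X_power_mult_nth)
  have "f z = eval_fps F (nome z)"
    using assms(1) z by (rule q_expansion_eq)
  also have "\<dots> = nome z ^ n * ?g z"
    using q_expansion_radius[OF g z] by (subst F, subst eval_fps_mult) auto
  finally show "f z = nome z ^ n * ?g z" .
qed

lemma q_expansion_tendsto:
  assumes "has_q_expansion f F" "e > 0"
  obtains Y where "\<And>z. Im z > Y \<Longrightarrow> norm (f z - fps_nth F 0) < e"
proof -
  have r: "fps_conv_radius F > 0"
    using assms q_expansion_radius_pos by blast+
  then have "isCont (eval_fps F) 0"
    by (auto simp: zero_ereal_def intro!: continuous_eval_fps)
  then obtain d where d: "d > 0" "\<And>x. norm x < d \<Longrightarrow> norm (eval_fps F x - fps_nth F 0) < e"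
    using assms(2) unfolding continuous_at_eps_delta dist_norm
    by (metis diff_zero eval_fps_at_0)
  \<comment> \<open>Beyond this height \<open>exp (- 2 * pi * Im z)\<close>, the norm of the nome,
    is below \<open>d\<close>; the maximum with 0 keeps \<open>z\<close> in the half-plane.\<close>
  have "norm (f z - fps_nth F 0) < e" if z: "Im z > max 0 (- ln d / (2 * pi))" for z
  proof -
    have "norm (nome z) < d"
    proof -
      have "- 2 * pi * Im z < ln d"
        using z by (simp add: field_simps)
      then show ?thesis
        using d(1) by (metis norm_nome exp_less_cancel_iff exp_ln)
    qed
    moreover have "f z = eval_fps F (nome z)"
      using z assms(1) by (intro q_expansion_eq) (auto simp: upper_half_plane_iff)
    ultimately show ?thesis
      using d(2) by simp
  qed
  then show ?thesis
    using that by blast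
qed

subsection \<open>Lambert series\<close>

text \<open>The constant coefficient is \<open>1 / 0 = 0\<close>.\<close>

definition lambert_fps :: "complex \<Rightarrow> complex fps" where
  "lambert_fps q = Abs_fps (\<lambda>d. q ^ d / (1 - q ^ d))"

lemma lambert_nth_0 [simp]: "fps_nth (lambert_fps q) 0 = 0"
  by (simp add: lambert_fps_def)

lemma norm_lambert_nth_le:
  assumes "norm q < 1"
  shows "norm (fps_nth (lambert_fps q) d) \<le> norm q ^ d / (1 - norm q)"
proof (cases "d = 0")
  case False
  then have "norm q ^ d \<le> norm q"
    using assms power_decreasing[of 1 d "norm q"] by simp
  then have "1 - norm q \<le> norm (1 - q ^ d)"
    using norm_triangle_ineq2[of 1 "q ^ d"] by (simp add: norm_power)
  then show ?thesis
    using assms by (auto simp: lambert_fps_def norm_divide norm_power intro!: divide_left_mono mult_pos_pos)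
qed (use assms in auto)

text \<open>The coefficients decay like \<open>norm q ^ d\<close>, so the series in \<open>x\<close>
  converges beyond the unit circle, up to \<open>1 / norm q\<close>. Bounding \<open>q * x\<close>
  instead covers \<open>q = 0\<close> as well.\<close>

lemma lambert_radius:
  assumes "norm q < 1" "norm (q * x) < 1"
  shows "ereal (norm x) < fps_conv_radius (lambert_fps q)"
proof -
  obtain r where r: "norm x < r" "norm q * r < 1"
  proof (cases "q = 0")
    case False
    then have "norm x < 1 / norm q"
      using assms by (simp add: field_simps norm_mult)
    then show ?thesis
      using dense[of "norm x" "1 / norm q"] that False by (auto simp: field_simps)
  qed (use that[of "norm x + 1"] in auto)
  have r0: "0 < r"
    using r(1) norm_ge_zero[of x] by linarith
  have "summable (\<lambda>d. fps_nth (lambert_fps q) d * of_real r ^ d)"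
  proof (rule summable_comparison_test')
    show "summable (\<lambda>d. (norm q * r) ^ d / (1 - norm q))"
      using r r0 by (intro summable_divide summable_geometric) auto
    show "norm (fps_nth (lambert_fps q) d * of_real r ^ d) \<le> (norm q * r) ^ d / (1 - norm q)" for d
      using mult_right_mono[OF norm_lambert_nth_le[OF assms(1), of d], of "r ^ d"] r0
      by (simp add: norm_mult norm_power power_mult_distrib)
  qed
  then have "ereal (norm (of_real r :: complex)) \<le> fps_conv_radius (lambert_fps q)"
    unfolding fps_conv_radius_def by (rule conv_radius_geI)
  then show ?thesis
    using r(1) r0 less_le_trans[of "ereal (norm x)" "ereal r"] by simp
qed

text \<open>The operator is \<open>q d/dq\<close>. Its powers insert \<open>d ^ k\<close> into the
  Lambert sums, and it returns when a series in \<open>nome u\<close> is differentiated in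
  \<open>u\<close>.\<close>

lemma fps_nth_theta_power:
  "fps_nth (((\<lambda>F. fps_X * fps_deriv F) ^^ k) F) n = of_nat n ^ k * (fps_nth F n :: complex)"
  by (induction k arbitrary: n) (auto simp: gr0_conv_Suc)

lemma fps_conv_radius_theta:
  "fps_conv_radius (F :: complex fps) \<le> fps_conv_radius (fps_X * fps_deriv F)"
  using fps_conv_radius_mult[of fps_X "fps_deriv F"] fps_conv_radius_deriv[of F]
  by (auto intro: order.trans)

lemma fps_conv_radius_theta_power:
  "fps_conv_radius (F :: complex fps) \<le> fps_conv_radius (((\<lambda>F. fps_X * fps_deriv F) ^^ k) F)"
  by (induction k) (auto intro: order.trans[OF _ fps_conv_radius_theta])

lemma summable_norm_lambert:
  fixes q :: complex
  assumes "norm q < 1"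
  shows "summable (\<lambda>d. norm (of_nat d ^ k * (q ^ d / (1 - q ^ d))))"
proof -
  let ?F = "((\<lambda>F. fps_X * fps_deriv F) ^^ k) (lambert_fps q)"
  have "ereal (norm (1::complex)) < fps_conv_radius ?F"
    using lambert_radius[of q 1] assms fps_conv_radius_theta_power[of "lambert_fps q" k]
    by (auto intro: less_le_trans)
  from norm_summable_fps[OF this] show ?thesis
    by (simp add: fps_nth_theta_power lambert_fps_def)
qed

text \<open>Every number divides 0, and a sum over an infinite set is 0. With this value the divisor
  series may start at index 0.\<close>

lemma divisor_sigma_0 [simp]: "divisor_sigma k 0 = 0"
  by (simp add: divisor_sigma_def)

text \<open>Both sides sum \<open>d ^ k * q ^ (d * m)\<close> over positive \<open>d\<close> and
  \<open>m\<close>: summing over \<open>m\<close> first gives the Lambert terms, collecting equal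
  products \<open>d * m\<close> gives the divisor sums. Absolute summability justifies the
  rearrangement.\<close>

lemma lambert_sums:
  fixes q :: complex
  assumes q: "norm q < 1"
  shows "(\<lambda>n. of_nat (divisor_sigma k n) * q ^ n) sums
           (\<Sum>d. of_nat d ^ k * (q ^ d / (1 - q ^ d)))"
proof -
  define f where "f = (\<lambda>(d::nat, m::nat). of_nat d ^ k * q ^ (d * m))"
  have geo: "((\<lambda>m. f (d, m)) has_sum of_nat d ^ k * (q ^ d / (1 - q ^ d))) {1..}"
    "((\<lambda>m. norm (f (d, m))) has_sum of_nat d ^ k * (norm q ^ d / (1 - norm q ^ d))) {1..}"
    if d: "d \<in> {1..}" for d
  proof -
    have *: "((\<lambda>m. x ^ (d * m)) has_sum (x ^ d / (1 - x ^ d))) {1..}"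
      if x: "norm x < 1" for x :: "'b :: {real_normed_field, banach}"
    proof -
      have xd: "norm (x ^ d) < 1"
        using x d by (simp add: norm_power power_less_one_iff)
      have "((\<lambda>m. (x ^ d) ^ m) has_sum x ^ d / (1 - x ^ d)) {1..}"
        using xd by (rule has_sum_geometric_from_1)
      then show ?thesis
        by (simp add: power_mult)
    qed
    show "((\<lambda>m. f (d, m)) has_sum of_nat d ^ k * (q ^ d / (1 - q ^ d))) {1..}"
      unfolding f_def using has_sum_cmult_right[OF *[OF q]] by simp
    show "((\<lambda>m. norm (f (d, m))) has_sum of_nat d ^ k * (norm q ^ d / (1 - norm q ^ d))) {1..}"
      unfolding f_def using has_sum_cmult_right[OF *[of "norm q"]] q
      by (simp add: norm_mult norm_power)
  qed
  have "(\<lambda>x. norm (f x)) summable_on {1..} \<times> {1..}"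
    unfolding Infinite_Sum.abs_summable_on_Sigma_iff
  proof (intro conjI ballI)
    show "(\<lambda>m. norm (f (d, m))) summable_on {1..}" if "d \<in> {1..}" for d
      using geo(2)[OF that] by (rule has_sum_imp_summable)
    have nq: "norm q ^ d \<le> 1" for d
      using q by (simp add: power_le_one)
    \<comment> \<open>Summing the norms over \<open>m\<close> gives the Lambert terms of the real
      number \<open>norm q\<close>, to which the complex lemma is applied.\<close>
    have "summable (\<lambda>d. norm (of_nat d ^ k * (complex_of_real (norm q) ^ d / (1 - of_real (norm q) ^ d))))"
      using q by (intro summable_norm_lambert) auto
    also have "(\<lambda>d. norm (of_nat d ^ k * (complex_of_real (norm q) ^ d / (1 - of_real (norm q) ^ d)))) =
               (\<lambda>d. of_nat d ^ k * (norm q ^ d / (1 - norm q ^ d)))"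
    proof
      fix d
      have "of_nat d ^ k * (complex_of_real (norm q) ^ d / (1 - of_real (norm q) ^ d)) =
            of_real (of_nat d ^ k * (norm q ^ d / (1 - norm q ^ d)))"
        by simp
      then show "norm (of_nat d ^ k * (complex_of_real (norm q) ^ d / (1 - of_real (norm q) ^ d))) =
          of_nat d ^ k * (norm q ^ d / (1 - norm q ^ d))"
        using nq[of d] by (metis norm_of_real abs_of_nonneg diff_ge_0_iff_ge divide_nonneg_nonneg
            mult_nonneg_nonneg norm_ge_zero of_nat_0_le_iff zero_le_power)
    qed
    finally have "(\<lambda>d. of_nat d ^ k * (norm q ^ d / (1 - norm q ^ d))) summable_on UNIV"
      using nq by (intro summable_nonneg_imp_summable_on) auto
    then have "(\<lambda>d. of_nat d ^ k * (norm q ^ d / (1 - norm q ^ d))) summable_on {1..}"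
      by (rule summable_on_subset_banach) auto
    moreover have "(\<Sum>\<^sub>\<infinity>m\<in>{1..}. norm (f (d, m))) = of_nat d ^ k * (norm q ^ d / (1 - norm q ^ d))"
      if "d \<in> {1..}" for d
      using geo(2)[OF that] by (rule infsumI)
    ultimately show "(\<lambda>d. norm (\<Sum>\<^sub>\<infinity>m\<in>{1..}. norm (f (d, m)))) summable_on {1..}"
      using nq by (subst summable_on_cong[where g = "\<lambda>d. of_nat d ^ k * (norm q ^ d / (1 - norm q ^ d))"]) auto
  qed
  then obtain S where S: "(f has_sum S) ({1..} \<times> {1..})"
    using Infinite_Sum.abs_summable_summable summable_on_def by blast
  have "((\<lambda>d. of_nat d ^ k * (q ^ d / (1 - q ^ d))) has_sum S) {1..}"
    by (rule has_sum_SigmaD[OF S]) (use geo(1) in simp)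
  then have "((\<lambda>d. of_nat d ^ k * (q ^ d / (1 - q ^ d))) has_sum S) UNIV"
    by (rule has_sum_cong_neutral[THEN iffD1, rotated -1]) (auto simp: not_le)
  then have S_eq: "(\<Sum>d. of_nat d ^ k * (q ^ d / (1 - q ^ d))) = S"
    by (rule sums_unique[OF has_sum_imp_sums, symmetric])
  \<comment> \<open>A pair \<open>(d, m)\<close> corresponds to \<open>n = d * m\<close> together
    with its divisor \<open>d\<close>.\<close>
  have "((\<lambda>(n, d). of_nat d ^ k * q ^ n) has_sum S) (Sigma {1..} (\<lambda>n. {d. d dvd n}))"
    by (rule has_sum_reindex_bij_witness[where i = "\<lambda>(d, m). (d * m, d)" and j = "\<lambda>(n, d). (d, n div d)",
          THEN iffD2, OF _ _ _ _ _ refl S])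
      (auto simp: f_def Suc_le_eq intro!: Nat.gr0I)
  then have "((\<lambda>n. of_nat (divisor_sigma k n) * q ^ n) has_sum S) {1..}"
  proof (rule has_sum_SigmaD)
    fix n :: nat assume "n \<in> {1..}"
    then have "finite {d. d dvd n}"
      by simp
    then show "((\<lambda>d. case (n, d) of (n, d) \<Rightarrow> of_nat d ^ k * q ^ n) has_sum
                  of_nat (divisor_sigma k n) * q ^ n) {d. d dvd n}"
      by (auto simp: divisor_sigma_def sum_distrib_right intro!: has_sum_finiteI)
  qed
  then have "((\<lambda>n. of_nat (divisor_sigma k n) * q ^ n) has_sum S) UNIV"
    by (rule has_sum_cong_neutral[THEN iffD1, rotated -1]) (auto simp: not_le)
  then show ?thesis
    unfolding S_eq by (rule has_sum_imp_sums)
qed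

subsection \<open>The behaviour of the Eisenstein series under inversion\<close>

text \<open>With \<open>1 / 0 = 0\<close> and \<open>cot 0 = 0\<close> this function takes the right value at \<open>0\<close>.\<close>

definition cot_reg :: "complex \<Rightarrow> complex" where
  "cot_reg u = cot u - 1 / u"

definition cot_reg_fps :: "complex fps" where
  "cot_reg_fps = (fps_X * fps_cos 1 - fps_sin 1) / (fps_X * fps_sin 1)"

lemma cot_reg_0 [simp]: "cot_reg 0 = 0"
  by (simp add: cot_reg_def)

text \<open>At 0 the function \<open>u cos u - sin u\<close> has order 3 and \<open>u sin u\<close>
  has order 2, so the division of power series is exact and the pole of the cotangent is
  removed.\<close>

lemma
  shows has_fps_expansion_cot_reg: "cot_reg has_fps_expansion cot_reg_fps"
    and cot_reg_fps_mult: "cot_reg_fps * (fps_X * fps_sin 1) = fps_X * fps_cos 1 - fps_sin 1"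
proof -
  let ?F = "fps_X * fps_cos 1 - fps_sin 1 :: complex fps"
  let ?G = "fps_X * fps_sin 1 :: complex fps"
  have G2: "fps_nth ?G 2 = 1"
    by (simp add: numeral_2_eq_2 fps_sin_def)
  have G: "subdegree ?G = 2"
    by (rule subdegreeI, use G2 in simp) (auto simp: fps_sin_def numeral_2_eq_2 less_Suc_eq)
  then have G: "?G \<noteq> 0" "subdegree ?G = 2"
    by (force, simp)
  have F: "fps_nth ?F i = 0" if "i \<le> 2" for i
    using that by (auto simp: numeral_2_eq_2 fps_sin_def fps_cos_def le_Suc_eq)
  have sub: "?F = 0 \<or> 2 \<le> subdegree ?F"
    using F by (metis subdegree_geI less_imp_le)
  have F0: "?F \<noteq> 0"
  proof
    assume "?F = 0"
    then have "fps_nth ?F 3 = 0"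
      by simp
    then show False
      by (simp add: numeral_3_eq_3 fps_sin_def fps_cos_def)
  qed
  have "?G dvd ?F"
    using sub G F0 fps_dvd_iff[of ?G ?F] by metis
  then show "cot_reg_fps * ?G = ?F"
    unfolding cot_reg_fps_def by simp
  have "(\<lambda>u. if u = 0 then 0 else (u * cos u - sin u) / (u * sin u)) has_fps_expansion cot_reg_fps"
    unfolding cot_reg_fps_def using sub G F[of 2] F[of "Suc (Suc 0)"] F0
    by (intro has_fps_expansion_divide has_fps_expansion_diff has_fps_expansion_mult
          has_fps_expansion_fps_X has_fps_expansion_cos' has_fps_expansion_sin') auto
  moreover have "eventually (\<lambda>u. (if u = 0 then 0 else (u * cos u - sin u) / (u * sin u)) = cot_reg u)
                   (nhds (0::complex))"
  proof -
    \<comment> \<open>The zeros of the sine are the multiples of \<pi>, so 0 is the only one in this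
      ball.\<close>
    have "eventually (\<lambda>u. u \<in> ball 0 pi) (nhds (0::complex))"
      by (intro eventually_nhds_in_open) auto
    then show ?thesis
    proof eventually_elim
      case (elim u)
      have "sin u \<noteq> 0" if "u \<noteq> 0"
      proof
        assume "sin u = 0"
        then obtain n :: int where n: "u = of_real (real_of_int n * pi)"
          by (auto simp: sin_eq_0)
        with elim have "\<bar>real_of_int n\<bar> < 1"
          by (simp add: norm_mult abs_mult)
        with n that show False
          by auto
      qed
      then show ?case
        by (auto simp: cot_reg_def cot_def field_simps)
    qed
  qed
  ultimately show "cot_reg has_fps_expansion cot_reg_fps"
    by (rule iffD1[OF has_fps_expansion_cong[OF _ refl], rotated])
qed

text \<open>Up to a sign, a power of 2 and a factorial these are the Bernoulli numbers of index 2, 4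
  and 6, which is how they match the normalization of the Eisenstein series.\<close>

lemma cot_reg_fps_nth:
  "fps_nth cot_reg_fps 1 = - 1 / 3"
  "fps_nth cot_reg_fps 3 = - 1 / 45"
  "fps_nth cot_reg_fps 5 = - 2 / 945"
proof -
  \<comment> \<open>Cancelling a factor \<open>fps_X\<close> shifts the index by one. As the sine
    starts in degree 1, the equation for \<open>m\<close> determines the coefficient of index
    \<open>m - 1\<close>.\<close>
  have eq: "(\<Sum>i=0..m. fps_nth cot_reg_fps i * fps_nth (fps_sin 1) (m - i)) =
      fps_nth (fps_cos 1) m - fps_nth (fps_sin 1) (Suc m)" for m
    using arg_cong[OF cot_reg_fps_mult, of "\<lambda>F. fps_nth F (Suc m)"]
    unfolding fps_mult_nth[symmetric] by (simp add: mult.left_commute[of _ fps_X])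
  have sin: "fps_nth (fps_sin 1) 0 = (0::complex)" "fps_nth (fps_sin 1) 1 = (1::complex)"
    "fps_nth (fps_sin 1) 2 = (0::complex)" "fps_nth (fps_sin 1) 3 = (- 1 / 6::complex)"
    "fps_nth (fps_sin 1) 4 = (0::complex)" "fps_nth (fps_sin 1) 5 = (1 / 120::complex)"
    "fps_nth (fps_sin 1) 6 = (0::complex)" "fps_nth (fps_sin 1) 7 = (- 1 / 5040::complex)"
    by (simp_all add: fps_sin_def fact_numeral)
  have cos: "fps_nth (fps_cos 1) 1 = (0::complex)" "fps_nth (fps_cos 1) 2 = (- 1 / 2::complex)"
    "fps_nth (fps_cos 1) 3 = (0::complex)" "fps_nth (fps_cos 1) 4 = (1 / 24::complex)"
    "fps_nth (fps_cos 1) 5 = (0::complex)" "fps_nth (fps_cos 1) 6 = (- 1 / 720::complex)"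
    by (simp_all add: fps_cos_def fact_numeral)
  have sums: "(\<Sum>i=0..1. f i) = f 0 + f 1" "(\<Sum>i=0..2. f i) = f 0 + f 1 + f 2"
    "(\<Sum>i=0..3. f i) = f 0 + f 1 + f 2 + f 3" "(\<Sum>i=0..4. f i) = f 0 + f 1 + f 2 + f 3 + f 4"
    "(\<Sum>i=0..5. f i) = f 0 + f 1 + f 2 + f 3 + f 4 + f 5"
    "(\<Sum>i=0..6. f i) = f 0 + f 1 + f 2 + f 3 + f 4 + f 5 + f 6" for f :: "nat \<Rightarrow> complex"
    by (simp_all add: numeral_eq_Suc)
  have c0: "fps_nth cot_reg_fps 0 = 0"
    using eq[of 1] unfolding sums by (simp add: sin cos Suc_1 del: One_nat_def)
  have c1: "fps_nth cot_reg_fps 1 = - 1 / 3"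
    using eq[of 2] unfolding sums by (simp add: sin cos c0 Suc_1 del: One_nat_def)
  have c2: "fps_nth cot_reg_fps 2 = 0"
    using eq[of 3] unfolding sums by (simp add: sin cos c0 c1 Suc_1 del: One_nat_def)
  have "fps_nth cot_reg_fps 3 =
      fps_nth (fps_cos 1) 4 - fps_nth (fps_sin 1) 5 - fps_nth cot_reg_fps 1 * fps_nth (fps_sin 1) 3"
    using eq[of 4] unfolding sums
    by (simp add: sin(1,2) c0 c2 Suc_1 algebra_simps del: One_nat_def)
  then have c3: "fps_nth cot_reg_fps 3 = - 1 / 45"
    by (simp only: c1 sin cos) simp
  have c4: "fps_nth cot_reg_fps 4 = 0"
    using eq[of 5] unfolding sums by (simp add: sin cos c0 c1 c2 c3 Suc_1 del: One_nat_def)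
  have "fps_nth cot_reg_fps 5 = fps_nth (fps_cos 1) 6 - fps_nth (fps_sin 1) 7
      - fps_nth cot_reg_fps 1 * fps_nth (fps_sin 1) 5 - fps_nth cot_reg_fps 3 * fps_nth (fps_sin 1) 3"
    using eq[of 6] unfolding sums
    by (simp add: sin(1,2) c0 c2 c4 Suc_1 algebra_simps del: One_nat_def)
  then have c5: "fps_nth cot_reg_fps 5 = - 2 / 945"
    by (simp only: c1 c3 sin cos) simp
  show "fps_nth cot_reg_fps 1 = - 1 / 3" "fps_nth cot_reg_fps 3 = - 1 / 45"
    "fps_nth cot_reg_fps 5 = - 2 / 945"
    by fact+
qed

lemma cot_reg_differentiable:
  assumes "u = 0 \<or> sin u \<noteq> 0"
  shows "cot_reg field_differentiable (at u)"
proof (cases "u = 0")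
  case True
  then show ?thesis
    using has_fps_expansion_imp_holomorphic[OF has_fps_expansion_cot_reg]
    by (metis holomorphic_on_imp_differentiable_at)
next
  case False
  then have "((\<lambda>u. 1 / u) has_field_derivative - (1 / u\<^sup>2)) (at u)"
    by (auto intro!: derivative_eq_intros simp: power2_eq_square)
  with False assms have "(cot_reg has_field_derivative - inverse ((sin u)\<^sup>2) - (- (1 / u\<^sup>2))) (at u)"
    unfolding cot_reg_def by (intro DERIV_diff DERIV_cot) auto
  then show ?thesis
    by (auto simp: field_differentiable_def)
qed

section \<open>The kernel in two descriptions and its periods\<close>

lemma cot_nome:
  assumes "nome u \<noteq> 1"
  shows "cot (of_real pi * u) = \<i> * (nome u + 1) / (nome u - 1)"
proof -
  define e where "e = exp (\<i> * (of_real pi * u))"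
  have e: "nome u = e\<^sup>2" "e \<noteq> 0" "exp (- (\<i> * (of_real pi * u))) = 1 / e"
    by (simp_all add: e_def nome_def exp_minus field_simps flip: exp_double)
  then have "e\<^sup>2 \<noteq> 1"
    using assms by simp
  then show ?thesis
    using e(2) unfolding e(1) cot_def cos_exp_eq sin_exp_eq e(3) e_def[symmetric]
    by (simp add: field_simps power2_eq_square)
qed

text \<open>The sine series in \<open>u\<close>, with each sine written as a difference of
  exponentials, so that both halves are values of a single power series.\<close>

definition kernel_lambert :: "complex \<Rightarrow> complex \<Rightarrow> complex" where
  "kernel_lambert z u = - 2 * of_real pi * \<i> *
     (eval_fps (lambert_fps (nome z)) (nome u) - eval_fps (lambert_fps (nome z)) (nome (- u)))"

text \<open>The Weierstrass zeta function of the lattice \<open>\<int> + \<int> z\<close>, up to a linear term.\<close>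

definition zeta_kernel :: "complex \<Rightarrow> complex \<Rightarrow> complex" where
  "zeta_kernel z u = of_real pi * cot (of_real pi * u) + kernel_lambert z u"

lemma kernel_radius:
  assumes "\<bar>Im u\<bar> < Im z"
  shows "ereal (norm (nome u)) < fps_conv_radius (lambert_fps (nome z))"
proof (rule lambert_radius)
  show "norm (nome z) < 1" "norm (nome z * nome u) < 1"
    using assms by (simp_all add: norm_nome_less_1_iff flip: nome_add)
qed

lemma kernel_lambert_0 [simp]: "kernel_lambert z 0 = 0"
  by (simp add: kernel_lambert_def)

lemma kernel_lambert_differentiable:
  assumes "\<bar>Im u\<bar> < Im z"
  shows "kernel_lambert z field_differentiable (at u)"
proof -
  note D = has_field_derivative_eval_fps_nome[OF kernel_radius]
  have "((\<lambda>u. eval_fps (lambert_fps (nome z)) (nome (- u))) has_field_derivative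
          (2 * of_real pi * \<i> * eval_fps (fps_X * fps_deriv (lambert_fps (nome z))) (nome (- u))) * (-1)) (at u)"
    using assms by (intro DERIV_chain2[OF D]) (auto intro!: derivative_eq_intros)
  from DERIV_cmult[OF DERIV_diff[OF D[OF assms] this], of "- 2 * of_real pi * \<i>"] show ?thesis
    unfolding kernel_lambert_def[abs_def] field_differentiable_def by (rule exI)
qed

lemma kernel_add_1:
  assumes "nome u \<noteq> 1"
  shows "zeta_kernel z (u + 1) = zeta_kernel z u"
proof -
  have "nome (u + 1) = nome u" "nome (- (u + 1)) = nome (- u)"
    by (simp_all only: nome_minus) (simp_all add: nome_add)
  with assms show ?thesis
    by (simp add: zeta_kernel_def kernel_lambert_def cot_nome)
qed

text \<open>With \<open>t = nome u\<close>, the shift multiplies the exponentials by powers of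
  \<open>q\<close>, and the differences cancel the denominators \<open>1 - q ^ d\<close>. What
  remains are geometric series in \<open>1 / t\<close> and \<open>t * q\<close>, convergent because
  \<open>Im u < 0 < Im (u + z)\<close>; they balance the change of the cotangent up to the
  constant.\<close>

lemma kernel_add_period:
  assumes u: "- Im z < Im u" "Im u < 0"
  shows "zeta_kernel z (u + z) = zeta_kernel z u - 2 * of_real pi * \<i>"
proof -
  define t q L where "t = nome u" and "q = nome z" and "L = eval_fps (lambert_fps q)"
  have t0: "t \<noteq> 0" "q \<noteq> 0"
    by (simp_all add: t_def q_def)
  have norms: "norm q < 1" "norm (1 / t) < 1" "norm (t * q) < 1"
    using u by (simp_all add: t_def q_def norm_nome_less_1_iff norm_divide flip: nome_add)
      (simp add: norm_nome mult_pos_neg)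
  have q1: "q ^ d \<noteq> 1" if "d > 0" for d
    using norms(1) that by (metis norm_one norm_power power_less_one_iff norm_ge_zero less_irrefl)
  have sL: "(\<lambda>d. q ^ d / (1 - q ^ d) * x ^ d) sums L x" if "norm (q * x) < 1" for x
    using sums_eval_fps[OF lambert_radius[OF norms(1) that]] by (simp add: L_def lambert_fps_def)
  have q2: "norm (q * (t * q)) < 1" "norm (q * (1 / (t * q))) < 1" "norm (q * t) < 1" "norm (q * (1 / t)) < 1"
    using norms t0 mult_strict_mono'[OF norms(1,2)] mult_strict_mono'[OF norms(1,3)]
    by (auto simp: norm_mult norm_divide mult_ac)
  have "(\<lambda>d. q ^ d / (1 - q ^ d) * (1 / (t * q)) ^ d - q ^ d / (1 - q ^ d) * (t * q) ^ d
            - q ^ d / (1 - q ^ d) * (1 / t) ^ d + q ^ d / (1 - q ^ d) * t ^ d) sums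
          (L (1 / (t * q)) - L (t * q) - L (1 / t) + L t)"
    by (intro sums_add sums_diff sL q2)
  \<comment> \<open>The Lambert coefficient of index 0 is 0, so the constant terms 1 of both
    geometric series are taken away.\<close>
  moreover have "(\<lambda>d. (1 / t) ^ d + (t * q) ^ d - (if d = 0 then 2 else 0)) sums
          (1 / (1 - 1 / t) + 1 / (1 - t * q) - 2)"
    using norms sums_single[of 0 "\<lambda>_. 2 :: complex"]
    by (intro sums_add sums_diff geometric_sums) auto
  moreover have "q ^ d / (1 - q ^ d) * (1 / (t * q)) ^ d - q ^ d / (1 - q ^ d) * (t * q) ^ d
            - q ^ d / (1 - q ^ d) * (1 / t) ^ d + q ^ d / (1 - q ^ d) * t ^ d
      = (1 / t) ^ d + (t * q) ^ d - (if d = 0 then 2 else 0)" for d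
  proof (cases "d = 0")
    case False
    define a b where "a = q ^ d" and "b = t ^ d"
    have "1 - a \<noteq> 0" "a \<noteq> 0" "b \<noteq> 0"
      using q1[of d] False t0 by (auto simp: a_def b_def)
    then have "a / (1 - a) * (1 / (b * a)) - a / (1 - a) * (b * a) - a / (1 - a) * (1 / b) + a / (1 - a) * b
        = 1 / b + b * a"
      by (simp add: divide_simps) (simp add: algebra_simps)
    then show ?thesis
      using False by (simp add: a_def b_def power_mult_distrib power_divide)
  qed auto
  ultimately have key: "L (1 / (t * q)) - L (t * q) - L (1 / t) + L t = 1 / (1 - 1 / t) + 1 / (1 - t * q) - 2"
    using sums_unique2 by simp
  have ne: "t \<noteq> 1" "t * q \<noteq> 1"
    using norms by auto
  have "cot (of_real pi * u) = \<i> * (t + 1) / (t - 1)"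
    using cot_nome[of u] ne by (simp add: t_def)
  moreover have "cot (of_real pi * (u + z)) = \<i> * (t * q + 1) / (t * q - 1)"
    using cot_nome[of "u + z"] ne by (simp add: t_def q_def nome_add)
  moreover have "nome u = t" "nome (u + z) = t * q" "nome (- u) = 1 / t" "nome (- (u + z)) = 1 / (t * q)"
    by (simp_all only: nome_minus) (simp_all add: nome_add t_def q_def field_simps)
  ultimately have "zeta_kernel z (u + z) - zeta_kernel z u =
      of_real pi * \<i> * ((t * q + 1) / (t * q - 1) - (t + 1) / (t - 1))
      + 2 * of_real pi * \<i> * (L (1 / (t * q)) - L (t * q) - L (1 / t) + L t)"
    unfolding zeta_kernel_def kernel_lambert_def q_def[symmetric] L_def[symmetric]
    by (simp add: algebra_simps)
  also have "\<dots> = of_real pi * \<i> * ((t * q + 1) / (t * q - 1) - (t + 1) / (t - 1)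
      + 2 * (1 / (1 - 1 / t) + 1 / (1 - t * q) - 2))"
    unfolding key by (simp add: algebra_simps)
  also have "(t * q + 1) / (t * q - 1) - (t + 1) / (t - 1) + 2 * (1 / (1 - 1 / t) + 1 / (1 - t * q) - 2) = - 2"
  proof -
    have "(t * q + 1) / (t * q - 1) = 1 + 2 / (t * q - 1)" "(t + 1) / (t - 1) = 1 + 2 / (t - 1)"
      "1 / (1 - 1 / t) = 1 + 1 / (t - 1)" "1 / (1 - t * q) = - 1 / (t * q - 1)"
      using ne t0 by (simp_all add: divide_simps)
    then show ?thesis
      by (simp add: algebra_simps)
  qed
  finally show ?thesis
    by (simp add: algebra_simps)
qed

text \<open>In the coordinates \<open>u = a + b z\<close> the strips belonging to the kernels of
  \<open>z\<close> and of \<open>- 1 / z\<close> become \<open>\<bar>b\<bar> < 1\<close> and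
  \<open>\<bar>a\<bar> < 1\<close>, so their intersection is an open parallelogram.\<close>

lemma lattice_region_coordinates:
  assumes "Im z > 0"
  shows "Im (of_real a + of_real b * z) = b * Im z"
    "Im ((of_real a + of_real b * z) / z) = - a * Im (- 1 / z)"
proof -
  have "(of_real a + of_real b * z) / z = of_real (- a) * (- 1 / z) + of_real b"
    using assms by (cases "z = 0") (auto simp: add_divide_distrib)
  moreover have "Im (of_real x * y + of_real b) = x * Im y" for x y
    by simp
  ultimately show "Im ((of_real a + of_real b * z) / z) = - a * Im (- 1 / z)"
    by metis
qed auto

lemma Im_inversion: "Im (- 1 / z) = Im z / (norm z)\<^sup>2"
  by (simp add: Im_divide cmod_power2)

lemma Im_inversion_pos: "Im z > 0 \<Longrightarrow> Im (- 1 / z) > 0"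
  unfolding Im_inversion by (intro divide_pos_pos) auto

text \<open>The difference of the zeta functions of the lattice \<open>\<int> + \<int> z\<close> in its two descriptions
  is doubly periodic without poles, hence constant; by oddness it vanishes.\<close>

proposition kernel_inversion:
  assumes z: "Im z > 0" and u: "\<bar>Im u\<bar> < Im z" "\<bar>Im (u / z)\<bar> < Im (- 1 / z)"
  shows "of_real pi * cot_reg (of_real pi * u) + kernel_lambert z u =
    (of_real pi * cot_reg (of_real pi * (u / z)) + kernel_lambert (- 1 / z) (u / z)) / z
      - 2 * of_real pi * \<i> * u / z"
proof -
  define w where "w = - 1 / z"
  define p where "p = (\<lambda>(a, b). complex_of_real a + of_real b * z)"
  define R where "R = {u. \<bar>Im u\<bar> < Im z \<and> \<bar>Im (u / z)\<bar> < Im w}"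
  define K where "K = (\<lambda>u. of_real pi * cot_reg (of_real pi * u) + kernel_lambert z u
    - (of_real pi * cot_reg (of_real pi * (u / z)) + kernel_lambert w (u / z)) / z
    + 2 * of_real pi * \<i> * u / z)"
  have z0: "z \<noteq> 0"
    using z by auto
  have w: "Im w > 0"
    unfolding w_def using z by (rule Im_inversion_pos)
  have p_surj: "\<exists>a b. u = p (a, b)" for u
    using z by (intro exI[of _ "Re u - Im u / Im z * Re z"] exI[of _ "Im u / Im z"])
      (simp add: p_def complex_eq_iff)
  have p_R: "p (a, b) \<in> R \<longleftrightarrow> \<bar>a\<bar> < 1 \<and> \<bar>b\<bar> < 1" for a b
    using z w lattice_region_coordinates[OF z, of a b]
    by (auto simp: R_def p_def w_def abs_mult)
  \<comment> \<open>The cotangents have their poles at the integers and at the integer multiples of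
    \<open>z\<close>; the origin is the only such point in \<open>R\<close>.\<close>
  have R_nome: "u = 0" if u_R: "u \<in> R" "nome u = 1 \<or> nome (u / z) = 1" for u
  proof -
    obtain a b where u: "u = p (a, b)"
      using p_surj by blast
    consider n :: int where "u = of_int n" | n :: int where "u = of_int n * z"
    proof -
      have "\<exists>n::int. u = of_int n \<or> u = of_int n * z"
        using u_R(2) z0 unfolding nome_eq_1_iff by (metis nonzero_divide_eq_eq)
      then show ?thesis
        using that by blast
    qed
    then show ?thesis
    proof cases
      case 1
      then have "\<bar>real_of_int n\<bar> < 1"
        using u_R(1) p_R[of "of_int n" 0] by (simp add: p_def)
      with 1 show ?thesis
        by auto
    next
      case 2
      then have "\<bar>real_of_int n\<bar> < 1"
        using u_R(1) p_R[of 0 "of_int n"] by (simp add: p_def)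
      with 2 show ?thesis
        by auto
    qed
  qed
  have K_kernel: "K u = zeta_kernel z u - zeta_kernel w (u / z) / z + 2 * of_real pi * \<i> * u / z" if "u \<noteq> 0" for u
    using that z0 by (simp add: K_def zeta_kernel_def cot_reg_def field_simps)
  \<comment> \<open>Since \<open>1 / z = - w\<close>, this shift is a backward period for the kernel
    of \<open>w\<close>. Its jump, divided by \<open>z\<close>, is what the linear term of
    \<open>K\<close> makes up for.\<close>
  have K_1: "K (u + 1) = K u" if u: "u \<in> R" "u + 1 \<in> R" for u
  proof -
    have "1 \<notin> R" "- 1 \<notin> R"
      using p_R[of 1 0] p_R[of "- 1" 0] by (auto simp: p_def)
    with u have nz: "u \<noteq> 0" "u + 1 \<noteq> 0"
      by (auto simp: add_eq_0_iff2)
    have eq: "(u + 1) / z + w = u / z"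
      using z0 by (simp add: w_def field_simps)
    then have "Im ((u + 1) / z) = Im (u / z) - Im w"
      by (metis add_diff_cancel_right' minus_complex.sel(2))
    then have "zeta_kernel w (u / z) = zeta_kernel w ((u + 1) / z) - 2 * of_real pi * \<i>"
      unfolding eq[symmetric] using u eq by (intro kernel_add_period) (auto simp: R_def)
    then have w_shift: "zeta_kernel w ((u + 1) / z) = zeta_kernel w (u / z) + 2 * of_real pi * \<i>"
      by simp
    have z_shift: "zeta_kernel z (u + 1) = zeta_kernel z u"
      using R_nome[OF u(1)] nz by (intro kernel_add_1) auto
    show ?thesis
      unfolding K_kernel[OF nz(1)] K_kernel[OF nz(2)] w_shift z_shift
      by (simp add: add_divide_distrib algebra_simps)
  qed
  \<comment> \<open>The roles are exchanged: the kernel of \<open>z\<close> jumps, while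
    \<open>u / z\<close> moves by 1.\<close>
  have K_z: "K (u + z) = K u" if u: "u \<in> R" "u + z \<in> R" for u
  proof -
    have "z \<notin> R" "- z \<notin> R"
      using p_R[of 0 1] p_R[of 0 "- 1"] by (auto simp: p_def)
    with u have nz: "u \<noteq> 0" "u + z \<noteq> 0"
      by (auto simp: add_eq_0_iff2)
    have z_shift: "zeta_kernel z (u + z) = zeta_kernel z u - 2 * of_real pi * \<i>"
      using u by (intro kernel_add_period) (auto simp: R_def)
    have w_shift: "zeta_kernel w ((u + z) / z) = zeta_kernel w (u / z)"
      using kernel_add_1[of "u / z" w] R_nome[OF u(1)] nz z0 by (auto simp: add_divide_distrib)
    show ?thesis
      unfolding K_kernel[OF nz(1)] K_kernel[OF nz(2)] w_shift z_shift
      using z0 by (simp add: add_divide_distrib algebra_simps)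
  qed
  have "open R"
    unfolding R_def using z0
    by (intro open_Collect_conj open_Collect_less continuous_intros) auto
  have "R = p ` ({- 1<..<1} \<times> {- 1<..<1})"
  proof (intro equalityI subsetI)
    fix u assume "u \<in> R"
    then show "u \<in> p ` ({- 1<..<1} \<times> {- 1<..<1})"
      using p_surj[of u] p_R by (force simp: abs_less_iff)
  qed (use p_R in \<open>auto simp: abs_less_iff\<close>)
  moreover have cont_p: "continuous_on A p" for A
    unfolding p_def case_prod_unfold by (intro continuous_intros)
  ultimately have "connected R"
    using connected_continuous_image[OF cont_p] by (simp add: connected_Times)
  have "K holomorphic_on R"
    unfolding holomorphic_on_def
  proof
    fix u assume u: "u \<in> R"
    have sin: "x = 0 \<or> sin (of_real pi * x) \<noteq> 0" if "nome x = 1 \<longrightarrow> x = 0" for x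
      using that by (auto simp: sin_eq_0 nome_eq_1_iff)
    have reg: "(\<lambda>x. cot_reg (of_real pi * x)) field_differentiable (at x)"
      if "nome x = 1 \<longrightarrow> x = 0" for x
      using sin[OF that]
      by (intro field_differentiable_compose[of "\<lambda>x. of_real pi * x" x cot_reg, unfolded o_def]
          cot_reg_differentiable derivative_intros) auto
    have div: "(\<lambda>x. f (x / z)) field_differentiable (at u)" if "f field_differentiable (at (u / z))" for f
      by (intro field_differentiable_compose[of "\<lambda>x. x / z" u f, unfolded o_def] that derivative_intros)
        (use z0 in auto)
    have "K field_differentiable (at u)"
      unfolding K_def using u R_nome[OF u] z0
      by (intro derivative_intros reg div[OF reg] div kernel_lambert_differentiable) (auto simp: R_def)
    then show "K field_differentiable (at u within R)"
      by (rule field_differentiable_at_within)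
  qed
  \<comment> \<open>Shifting a coordinate by 1 inside (- 1, 1) brings every point of
    \<open>R\<close> into the compact \<open>P\<close> without leaving \<open>R\<close>. The maximum
    over \<open>P\<close> is therefore a maximum over the open set \<open>R\<close>.\<close>
  define P where "P = p ` ({- 1 / 2..1 / 2} \<times> {- 1 / 2..1 / 2})"
  have "P \<subseteq> R"
    using p_R by (force simp: P_def)
  have "compact P"
    unfolding P_def by (intro compact_continuous_image cont_p compact_Times compact_Icc)
  moreover have "P \<noteq> {}"
    by (auto simp: P_def)
  moreover have "continuous_on P (\<lambda>u. norm (K u))"
    using \<open>K holomorphic_on R\<close> \<open>P \<subseteq> R\<close>
    by (intro continuous_on_norm holomorphic_on_imp_continuous_on) (rule holomorphic_on_subset)
  ultimately obtain u0 where u0: "u0 \<in> P" "\<And>u. u \<in> P \<Longrightarrow> norm (K u) \<le> norm (K u0)"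
    using continuous_attains_sup by metis
  have "norm (K u) \<le> norm (K u0)" if "u \<in> R" for u
  proof -
    obtain a b where ab: "u = p (a, b)" "\<bar>a\<bar> < 1" "\<bar>b\<bar> < 1"
      using p_surj \<open>u \<in> R\<close> p_R by metis
    have shift_1: "K (p (a + 1, b)) = K (p (a, b))" if "\<bar>a\<bar> < 1" "\<bar>a + 1\<bar> < 1" "\<bar>b\<bar> < 1" for a b
      using K_1[of "p (a, b)"] p_R[of a b] p_R[of "a + 1" b] that by (simp add: p_def algebra_simps)
    have shift_z: "K (p (a, b + 1)) = K (p (a, b))" if "\<bar>a\<bar> < 1" "\<bar>b\<bar> < 1" "\<bar>b + 1\<bar> < 1" for a b
      using K_z[of "p (a, b)"] p_R[of a b] p_R[of a "b + 1"] that by (simp add: p_def algebra_simps)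
    obtain a' where a': "\<bar>a'\<bar> \<le> 1 / 2" "K (p (a', b)) = K (p (a, b))"
    proof -
      consider "\<bar>a\<bar> \<le> 1 / 2" | "a < - 1 / 2" | "a > 1 / 2"
        by linarith
      then show ?thesis
      proof cases
        case 2
        then show ?thesis
          using that[of "a + 1"] shift_1[of a b] ab by auto
      next
        case 3
        then show ?thesis
          using that[of "a - 1"] shift_1[of "a - 1" b] ab by auto
      qed (use that in auto)
    qed
    obtain b' where b': "\<bar>b'\<bar> \<le> 1 / 2" "K (p (a', b')) = K (p (a', b))"
    proof -
      consider "\<bar>b\<bar> \<le> 1 / 2" | "b < - 1 / 2" | "b > 1 / 2"
        by linarith
      then show ?thesis
      proof cases
        case 2
        then show ?thesis
          using that[of "b + 1"] shift_z[of a' b] ab a' by auto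
      next
        case 3
        then show ?thesis
          using that[of "b - 1"] shift_z[of a' "b - 1"] ab a' by auto
      qed (use that in auto)
    qed
    have "p (a', b') \<in> P"
      using a' b' by (auto simp: P_def abs_le_iff intro!: image_eqI[of _ p "(a', b')"])
    then show ?thesis
      using u0(2)[of "p (a', b')"] a'(2) b'(2) ab(1) by simp
  qed
  then have "K constant_on R"
    using \<open>K holomorphic_on R\<close> \<open>open R\<close> \<open>connected R\<close> u0(1) \<open>P \<subseteq> R\<close>
    by (intro maximum_modulus_principle[where U = R and \<xi> = u0]) auto
  moreover have "0 \<in> R" "u \<in> R"
    using z w u by (auto simp: R_def w_def)
  ultimately have "K u = K 0"
    unfolding constant_on_def by metis
  also have "K 0 = 0"
    by (simp add: K_def)
  finally show ?thesis
    by (simp add: K_def w_def algebra_simps)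
qed

section \<open>Taylor coefficients of the kernel at the origin\<close>

lemma higher_deriv_eval_fps_nome:
  assumes "ereal (norm (nome (c * u))) < fps_conv_radius F"
  shows "(deriv ^^ n) (\<lambda>u. eval_fps F (nome (c * u))) u =
    (2 * of_real pi * \<i> * c) ^ n * eval_fps (((\<lambda>F. fps_X * fps_deriv F) ^^ n) F) (nome (c * u))"
  using assms
proof (induction n arbitrary: u)
  case (Suc n)
  let ?S = "{u. ereal (norm (nome (c * u))) < fps_conv_radius F}"
  let ?F = "((\<lambda>F. fps_X * fps_deriv F) ^^ n) F"
  have "open ((\<lambda>u. nome (c * u)) -` eball 0 (fps_conv_radius F))"
    by (intro open_vimage open_eball) (auto simp: nome_def intro!: continuous_intros)
  then have "open ?S"
    by (simp add: vimage_def)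
  then have "eventually (\<lambda>u. (deriv ^^ n) (\<lambda>u. eval_fps F (nome (c * u))) u =
      (2 * of_real pi * \<i> * c) ^ n * eval_fps ?F (nome (c * u))) (nhds u)"
    using eventually_nhds_in_open[of ?S u] Suc by (auto elim!: eventually_mono)
  then have "(deriv ^^ Suc n) (\<lambda>u. eval_fps F (nome (c * u))) u =
      deriv (\<lambda>u. (2 * of_real pi * \<i> * c) ^ n * eval_fps ?F (nome (c * u))) u"
    by (auto intro: deriv_cong_ev)
  also have "\<dots> = (2 * of_real pi * \<i> * c) ^ n *
      (2 * of_real pi * \<i> * eval_fps (fps_X * fps_deriv ?F) (nome (c * u)) * c)"
  proof (intro DERIV_imp_deriv DERIV_cmult)
    have "ereal (norm (nome (c * u))) < fps_conv_radius ?F"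
      using Suc.prems fps_conv_radius_theta_power by (rule less_le_trans)
    then show "((\<lambda>u. eval_fps ?F (nome (c * u))) has_field_derivative
        2 * of_real pi * \<i> * eval_fps (fps_X * fps_deriv ?F) (nome (c * u)) * c) (at u)"
      by (intro DERIV_chain2[OF has_field_derivative_eval_fps_nome]) (auto intro!: derivative_eq_intros)
  qed
  finally show ?case
    by (simp add: mult_ac)
qed auto

text \<open>The nome is 1 at the origin, so this is no formal composition of power series; the
  coefficients come from derivatives, evaluated at the point 1 inside the disc of
  convergence.\<close>

lemma has_fps_expansion_eval_fps_nome:
  assumes "1 < fps_conv_radius F"
  shows "(\<lambda>u. eval_fps F (nome (c * u))) has_fps_expansion
    Abs_fps (\<lambda>n. (2 * of_real pi * \<i> * c) ^ n / fact n * eval_fps (((\<lambda>F. fps_X * fps_deriv F) ^^ n) F) 1)"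
proof -
  let ?S = "(\<lambda>u. nome (c * u)) -` eball 0 (fps_conv_radius F)"
  have "open ?S"
    by (intro open_vimage open_eball) (auto simp: nome_def intro!: continuous_intros)
  moreover have "0 \<in> ?S"
    using assms by (simp add: one_ereal_def)
  moreover have "(\<lambda>u. eval_fps F (nome (c * u))) holomorphic_on ?S"
    by (intro holomorphic_on_compose_gen[OF _ holomorphic_on_eval_fps[OF order_refl], unfolded o_def]
        holomorphic_intros) auto
  ultimately have "(\<lambda>u. eval_fps F (nome (c * u))) has_fps_expansion
      fps_expansion (\<lambda>u. eval_fps F (nome (c * u))) 0"
    by (rule has_fps_expansion_fps_expansion)
  also have "fps_expansion (\<lambda>u. eval_fps F (nome (c * u))) 0 =
      Abs_fps (\<lambda>n. (2 * of_real pi * \<i> * c) ^ n / fact n * eval_fps (((\<lambda>F. fps_X * fps_deriv F) ^^ n) F) 1)"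
    using assms by (simp add: fps_expansion_def higher_deriv_eval_fps_nome one_ereal_def)
  finally show ?thesis .
qed

text \<open>The Lambert part survives for odd \<open>n\<close> only, where its sum is the one in the
  Eisenstein series of weight \<open>n + 1\<close>.\<close>

lemma kernel_lambert_expansion:
  assumes "Im z > 0"
  shows "(\<lambda>u. of_real pi * cot_reg (of_real pi * u) + kernel_lambert z u) has_fps_expansion
    Abs_fps (\<lambda>n. of_real pi ^ Suc n * fps_nth cot_reg_fps n - (2 * of_real pi * \<i>) ^ Suc n / fact n *
      (1 - (- 1) ^ n) * (\<Sum>d. of_nat d ^ n * (nome z ^ d / (1 - nome z ^ d))))" (is "_ has_fps_expansion ?H")
proof -
  let ?L = "lambert_fps (nome z)"
  let ?A = "\<lambda>c. Abs_fps (\<lambda>n. (2 * of_real pi * \<i> * c) ^ n / fact n *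
      eval_fps (((\<lambda>F. fps_X * fps_deriv F) ^^ n) ?L) 1)"
  have "1 < fps_conv_radius ?L"
    using kernel_radius[of 0 z] assms by (simp add: one_ereal_def)
  note L = has_fps_expansion_eval_fps_nome[OF this]
  have "(cot_reg \<circ> (\<lambda>u. of_real pi * u)) has_fps_expansion (cot_reg_fps oo (fps_const (of_real pi) * fps_X))"
    by (intro has_fps_expansion_compose has_fps_expansion_cot_reg fps_expansion_intros) auto
  then have "(\<lambda>u. of_real pi * cot_reg (of_real pi * u) +
        (- 2 * of_real pi * \<i>) * (eval_fps ?L (nome (1 * u)) - eval_fps ?L (nome (- 1 * u)))) has_fps_expansion
      fps_const (of_real pi) * (cot_reg_fps oo (fps_const (of_real pi) * fps_X)) +
      fps_const (- 2 * of_real pi * \<i>) * (?A 1 - ?A (- 1))"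
    unfolding o_def
    by (intro has_fps_expansion_add has_fps_expansion_cmult_left has_fps_expansion_diff L)
  also have "fps_const (of_real pi) * (cot_reg_fps oo (fps_const (of_real pi) * fps_X)) +
      fps_const (- 2 * of_real pi * \<i>) * (?A 1 - ?A (- 1)) = ?H"
  proof (rule fps_ext)
    fix n
    define S where "S = (\<Sum>d. of_nat d ^ n * (nome z ^ d / (1 - nome z ^ d)))"
    define p where "p = (2 * of_real pi * \<i>) ^ n"
    have "eval_fps (((\<lambda>F. fps_X * fps_deriv F) ^^ n) ?L) 1 = S"
      by (simp add: eval_fps_def fps_nth_theta_power lambert_fps_def S_def)
    moreover have "(2 * of_real pi * \<i> * - 1) ^ n = p * (- 1 :: complex) ^ n"
      unfolding p_def by (rule power_mult_distrib)
    ultimately have "fps_nth (fps_const (of_real pi) * (cot_reg_fps oo (fps_const (of_real pi) * fps_X)) +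
      fps_const (- 2 * of_real pi * \<i>) * (?A 1 - ?A (- 1))) n =
      of_real pi * (of_real pi ^ n * fps_nth cot_reg_fps n) +
      (- 2 * of_real pi * \<i>) * (p / fact n * S - p * (- 1) ^ n / fact n * S)"
      unfolding fps_compose_linear fps_add_nth fps_mult_left_const_nth fps_sub_nth fps_nth_Abs_fps
      by (simp only: p_def mult_1_right)
    also have "\<dots> = of_real pi ^ Suc n * fps_nth cot_reg_fps n - 2 * of_real pi * \<i> * p / fact n * (1 - (- 1) ^ n) * S"
      by (simp add: algebra_simps diff_divide_distrib)
    also have "\<dots> = fps_nth ?H n"
      by (simp add: p_def S_def)
    finally show "fps_nth (fps_const (of_real pi) * (cot_reg_fps oo (fps_const (of_real pi) * fps_X)) +
      fps_const (- 2 * of_real pi * \<i>) * (?A 1 - ?A (- 1))) n = fps_nth ?H n" .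
  qed
  finally show ?thesis
    by (simp add: kernel_lambert_def)
qed

text \<open>This compares coefficients of \<open>u ^ n\<close> in \<open>kernel_inversion\<close>.
  The argument \<open>u / z\<close> and the prefactor \<open>1 / z\<close> together produce weight
  \<open>n + 1\<close>; the linear term is felt for \<open>n = 1\<close> alone.\<close>

lemma kernel_expansion_inversion:
  assumes z: "Im z > 0"
  defines "c \<equiv> \<lambda>z n. of_real pi ^ Suc n * fps_nth cot_reg_fps n - (2 * of_real pi * \<i>) ^ Suc n / fact n *
      (1 - (- 1) ^ n) * (\<Sum>d. of_nat d ^ n * (nome z ^ d / (1 - nome z ^ d)))"
  shows "c (- 1 / z) n = z ^ Suc n * c z n + (if n = 1 then 2 * of_real pi * \<i> * z else 0)"
proof -
  define w where "w = - 1 / z"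
  define h where "h = (\<lambda>z u. of_real pi * cot_reg (of_real pi * u) + kernel_lambert z u)"
  have z0: "z \<noteq> 0" and w: "Im w > 0"
    using z Im_inversion_pos by (auto simp: w_def)
  have expansion: "h z has_fps_expansion Abs_fps (c z)" if "Im z > 0" for z
    using kernel_lambert_expansion[OF that] unfolding h_def c_def .
  have "(h w \<circ> (\<lambda>u. 1 / z * u)) has_fps_expansion (Abs_fps (c w) oo (fps_const (1 / z) * fps_X))"
    by (intro has_fps_expansion_compose expansion w fps_expansion_intros) auto
  then have R: "(\<lambda>u. 1 / z * h w (1 / z * u) - 2 * of_real pi * \<i> / z * u) has_fps_expansion
      fps_const (1 / z) * (Abs_fps (c w) oo (fps_const (1 / z) * fps_X)) -
      fps_const (2 * of_real pi * \<i> / z) * fps_X"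
    unfolding o_def
    by (intro has_fps_expansion_diff has_fps_expansion_cmult_left has_fps_expansion_fps_X)
  have "open {u. \<bar>Im u\<bar> < Im z \<and> \<bar>Im (u / z)\<bar> < Im w}"
    using z0 by (intro open_Collect_conj open_Collect_less continuous_intros) auto
  then have "eventually (\<lambda>u. u \<in> {u. \<bar>Im u\<bar> < Im z \<and> \<bar>Im (u / z)\<bar> < Im w}) (nhds 0)"
    using z w by (intro eventually_nhds_in_open) auto
  then have "eventually (\<lambda>u. 1 / z * h w (1 / z * u) - 2 * of_real pi * \<i> / z * u = h z u) (nhds 0)"
  proof eventually_elim
    case (elim u)
    then show ?case
      using kernel_inversion[OF z, of u] by (simp add: h_def w_def)
  qed
  with R have "h z has_fps_expansion fps_const (1 / z) * (Abs_fps (c w) oo (fps_const (1 / z) * fps_X)) -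
      fps_const (2 * of_real pi * \<i> / z) * fps_X"
    by (rule iffD1[OF has_fps_expansion_cong[OF _ refl], rotated])
  from fps_expansion_unique_complex[OF this expansion[OF z]]
  have "fps_nth (Abs_fps (c z)) n = fps_nth (fps_const (1 / z) * (Abs_fps (c w) oo (fps_const (1 / z) * fps_X)) -
      fps_const (2 * of_real pi * \<i> / z) * fps_X) n"
    by simp
  then have "c z n = 1 / z * (1 / z) ^ n * c w n - (if n = 1 then 2 * of_real pi * \<i> / z else 0)"
    by (simp add: fps_compose_linear)
  then have "z ^ Suc n * c z n =
      z ^ Suc n * (1 / z * (1 / z) ^ n * c w n - (if n = 1 then 2 * of_real pi * \<i> / z else 0))"
    by (rule arg_cong)
  also have "\<dots> = c w n - (if n = 1 then 2 * of_real pi * \<i> * z else 0)"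
    using z0 by (simp add: power_divide right_diff_distrib)
  finally show ?thesis
    by (simp add: w_def)
qed

lemma bernoulli_values: "bernoulli 2 = 1 / 6" "bernoulli 4 = - 1 / 30" "bernoulli 6 = 1 / 42"
  by (simp_all add: eval_nat_numeral binomial_Suc_Suc)

lemma eisenstein_lambert:
  assumes "Im z > 0"
  shows "eisenstein k z = 1 - of_nat (2 * k) / of_real (bernoulli k) *
    (\<Sum>d. of_nat d ^ (k - 1) * (nome z ^ d / (1 - nome z ^ d)))"
proof -
  have "norm (nome z) < 1"
    using assms by (simp add: norm_nome_less_1_iff)
  from lambert_sums[OF this, of "k - 1"] have
    "(\<lambda>n. of_nat (divisor_sigma (k - 1) (Suc n)) * nome z ^ Suc n) sums
       (\<Sum>d. of_nat d ^ (k - 1) * (nome z ^ d / (1 - nome z ^ d)))"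
    by (subst sums_Suc_iff) simp
  then have "(\<Sum>n. of_nat (divisor_sigma (k - 1) (Suc n)) * nome z ^ Suc n) =
      (\<Sum>d. of_nat d ^ (k - 1) * (nome z ^ d / (1 - nome z ^ d)))"
    by (rule sums_unique[symmetric])
  with assms show ?thesis
    by (simp add: eisenstein_def upper_half_plane_iff)
qed

theorem eisenstein_inversion:
  assumes z: "z \<in> upper_half_plane"
  shows "eisenstein 2 (- 1 / z) = z\<^sup>2 * eisenstein 2 z + 6 * z / (of_real pi * \<i>)"
    and "eisenstein 4 (- 1 / z) = z ^ 4 * eisenstein 4 z"
    and "eisenstein 6 (- 1 / z) = z ^ 6 * eisenstein 6 z"
proof -
  have z': "Im z > 0"
    using z by (simp add: upper_half_plane_iff)
  have pi_nz: "complex_of_real pi \<noteq> 0"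
    by simp
  define c where "c = (\<lambda>z n. of_real pi ^ Suc n * fps_nth cot_reg_fps n - (2 * of_real pi * \<i>) ^ Suc n / fact n *
      (1 - (- 1) ^ n) * (\<Sum>d. of_nat d ^ n * (nome z ^ d / (1 - nome z ^ d))))"
  have c: "c (- 1 / z) n = z ^ Suc n * c z n + (if n = 1 then 2 * of_real pi * \<i> * z else 0)" for n
    unfolding c_def using kernel_expansion_inversion[OF z'] .
  \<comment> \<open>Here and for 3 and 5 the factor is \<open>pi ^ Suc n\<close> times the cotangent
    coefficient, since the series starts with 1.\<close>
  have c1: "c z 1 = - (of_real pi ^ 2 / 3) * eisenstein 2 z" if "Im z > 0" for z
    unfolding c_def cot_reg_fps_nth eisenstein_lambert[OF that] bernoulli_values
    by (simp add: power_mult_distrib fact_numeral field_simps power_numeral_reduce)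
  have c3: "c z 3 = - (of_real pi ^ 4 / 45) * eisenstein 4 z" if "Im z > 0" for z
    unfolding c_def cot_reg_fps_nth eisenstein_lambert[OF that] bernoulli_values
    by (simp add: power_mult_distrib fact_numeral field_simps power_numeral_reduce)
  have c5: "c z 5 = - (2 * of_real pi ^ 6 / 945) * eisenstein 6 z" if "Im z > 0" for z
    unfolding c_def cot_reg_fps_nth eisenstein_lambert[OF that] bernoulli_values
    by (simp add: power_mult_distrib fact_numeral field_simps power_numeral_reduce)
  have w: "Im (- 1 / z) > 0"
    using z' by (rule Im_inversion_pos)
  show "eisenstein 4 (- 1 / z) = z ^ 4 * eisenstein 4 z"
    using c[of 3] pi_nz unfolding c3[OF z'] c3[OF w] by (simp add: field_simps)
  show "eisenstein 6 (- 1 / z) = z ^ 6 * eisenstein 6 z"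
    using c[of 5] pi_nz unfolding c5[OF z'] c5[OF w] by (simp add: field_simps)
  \<comment> \<open>Dividing the anomaly \<open>2 \<pi> \<i> z\<close> by
    \<open>- \<pi>^2 / 3\<close> gives \<open>6 z / (\<pi> \<i>)\<close>.\<close>
  have "- (of_real pi ^ 2 / 3) * eisenstein 2 (- 1 / z) =
      - (of_real pi ^ 2 / 3) * (z\<^sup>2 * eisenstein 2 z + 6 * z / (of_real pi * \<i>))"
    using c[of 1] pi_nz unfolding c1[OF z'] c1[OF w] by (simp add: field_simps power2_eq_square)
  then show "eisenstein 2 (- 1 / z) = z\<^sup>2 * eisenstein 2 z + 6 * z / (of_real pi * \<i>)"
    using pi_nz by (subst (asm) mult_left_cancel) auto
qed

definition eisenstein_fps :: "nat \<Rightarrow> complex fps" where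
  "eisenstein_fps k = 1 - fps_const (of_nat (2 * k) / of_real (bernoulli k)) *
     Abs_fps (\<lambda>n. of_nat (divisor_sigma (k - 1) n))"

lemma eisenstein_q_expansion: "has_q_expansion (eisenstein k) (eisenstein_fps k)"
proof -
  have "has_q_expansion (\<lambda>z. \<Sum>d. of_nat d ^ (k - 1) * (nome z ^ d / (1 - nome z ^ d)))
      (Abs_fps (\<lambda>n. of_nat (divisor_sigma (k - 1) n)))"
    unfolding has_q_expansion_def fps_nth_Abs_fps
    by (intro ballI lambert_sums) (simp add: norm_nome_less_1_iff upper_half_plane_iff)
  from q_expansion_diff[OF q_expansion_const[of 1] q_expansion_scale[OF this]]
  have "has_q_expansion (\<lambda>z. 1 - of_nat (2 * k) / of_real (bernoulli k) *
      (\<Sum>d. of_nat d ^ (k - 1) * (nome z ^ d / (1 - nome z ^ d)))) (eisenstein_fps k)"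
    unfolding eisenstein_fps_def fps_const_1_eq_1 .
  then show ?thesis
    by (rule q_expansion_cong) (simp add: eisenstein_lambert upper_half_plane_iff)
qed

lemma eisenstein_fps_nth_0: "fps_nth (eisenstein_fps k) 0 = 1"
  by (simp add: eisenstein_fps_def)

lemma eisenstein_fps_nth_1:
  "fps_nth (eisenstein_fps 2) 1 = - 24" "fps_nth (eisenstein_fps 4) 1 = 240" "fps_nth (eisenstein_fps 6) 1 = - 504"
  by (simp_all add: eisenstein_fps_def divisor_sigma_def bernoulli_values)

subsection \<open>Modular forms\<close>

lemma upper_half_plane_nonzero: "z \<in> upper_half_plane \<Longrightarrow> z \<noteq> 0"
  by (auto simp: upper_half_plane_iff)

lemma upper_half_plane_inversion: "z \<in> upper_half_plane \<Longrightarrow> - 1 / z \<in> upper_half_plane"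
  using Im_inversion_pos by (simp add: upper_half_plane_iff)

lemma
  fixes a b c d :: int
  assumes z: "z \<in> upper_half_plane" and det: "a * d - b * c = 1"
  shows moebius_denominator_nonzero: "of_int c * z + of_int d \<noteq> 0"
    and upper_half_plane_moebius:
      "(of_int a * z + of_int b) / (of_int c * z + of_int d) \<in> upper_half_plane"
proof -
  have Im: "Im z > 0"
    using z by (simp add: upper_half_plane_iff)
  show nz: "of_int c * z + of_int d \<noteq> 0"
  proof
    assume "of_int c * z + of_int d = 0"
    then have "Im (of_int c * z + of_int d) = 0" "Re (of_int c * z + of_int d) = 0"
      by simp_all
    then have "c = 0" "d = 0"
      using Im by auto
    then show False
      using det by simp
  qed
  have "Im ((of_int a * z + of_int b) / (of_int c * z + of_int d)) =
      (of_int (a * d - b * c) * Im z) / (norm (of_int c * z + of_int d))\<^sup>2"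
    by (simp add: Im_divide cmod_power2 algebra_simps)
  then show "(of_int a * z + of_int b) / (of_int c * z + of_int d) \<in> upper_half_plane"
    using Im nz det by (simp add: upper_half_plane_iff)
qed

lemma q_expansion_periodic_int:
  assumes "has_q_expansion f F" "z \<in> upper_half_plane"
  shows "f (z + of_int n) = f z"
proof -
  have "nome (z + of_int n) = nome z"
    by (metis nome_add nome_eq_1_iff mult_1_right)
  with assms show ?thesis
    by (simp add: q_expansion_eq upper_half_plane_iff)
qed

text \<open>The Euclidean algorithm writes every matrix of determinant 1 in terms of
  \<open>z \<mapsto> z + 1\<close> and \<open>z \<mapsto> - 1 / z\<close>.\<close>

lemma modular_transformation_from_generators:
  fixes a b c d :: int
  assumes f: "has_q_expansion f F" and k: "even k"
    and inversion: "\<And>z. z \<in> upper_half_plane \<Longrightarrow> f (- 1 / z) = z powi k * f z"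
    and "a * d - b * c = 1" "z \<in> upper_half_plane"
  shows "f ((of_int a * z + of_int b) / (of_int c * z + of_int d)) =
    (of_int c * z + of_int d) powi k * f z"
  using assms(4)
proof (induction "nat \<bar>c\<bar>" arbitrary: a b c d rule: less_induct)
  case less
  show ?case
  proof (cases "c = 0")
    case True
    \<comment> \<open>Both cases are translations; for \<open>a = d = - 1\<close> the factor
      \<open>(- 1) powi k\<close> is 1 because \<open>k\<close> is even.\<close>
    with less.prems have "(a = 1 \<and> d = 1) \<or> (a = - 1 \<and> d = - 1)"
      by (simp add: zmult_eq_1_iff)
    then show ?thesis
      using True k q_expansion_periodic_int[OF f assms(5), of b]
        q_expansion_periodic_int[OF f assms(5), of "- b"] by auto
  next
    case False
    define q r where "q = a div c" and "r = a mod c"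
    define s where "s = b - q * d"
    have a: "a = q * c + r"
      by (simp add: q_def r_def)
    \<comment> \<open>Undoing the translation by \<open>q\<close> and an inversion leaves the matrix
      with rows \<open>(c, d)\<close> and \<open>(- r, - s)\<close>, whose lower left entry is
      smaller than \<open>c\<close> in absolute value.\<close>
    have det: "c * (- s) - d * (- r) = 1"
      using less.prems by (simp add: s_def a algebra_simps)
    have "nat \<bar>- r\<bar> < nat \<bar>c\<bar>"
      using False abs_mod_less[of c a] by (simp add: r_def)
    note IH = less.hyps[OF this det]
    define y where "y = (of_int c * z + of_int d) / (of_int (- r) * z + of_int (- s))"
    have nz: "of_int (- r) * z + of_int (- s) \<noteq> 0" "of_int c * z + of_int d \<noteq> 0"
      using moebius_denominator_nonzero[OF assms(5) det] moebius_denominator_nonzero[OF assms(5) less.prems]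
      by (simp_all only: not_False_eq_True)
    have y: "y \<in> upper_half_plane"
      unfolding y_def using upper_half_plane_moebius[OF assms(5) det] .
    have y': "- 1 / y = (of_int r * z + of_int s) / (of_int c * z + of_int d)"
      using nz by (simp add: y_def divide_simps)
    have "(of_int a * z + of_int b) / (of_int c * z + of_int d) = - 1 / y + of_int q"
      unfolding y' using nz(2) by (simp add: a s_def field_simps)
    then have "f ((of_int a * z + of_int b) / (of_int c * z + of_int d)) = f (- 1 / y)"
      using q_expansion_periodic_int[OF f upper_half_plane_inversion[OF y]] by simp
    also have "\<dots> = y powi k * f y"
      using y by (rule inversion)
    also have "f y = (of_int (- r) * z + of_int (- s)) powi k * f z"
      unfolding y_def by (rule IH)
    also have "y powi k * ((of_int (- r) * z + of_int (- s)) powi k * f z) =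
        (y * (of_int (- r) * z + of_int (- s))) powi k * f z"
      by (simp only: power_int_mult_distrib mult.assoc)
    also have "y * (of_int (- r) * z + of_int (- s)) = of_int c * z + of_int d"
      unfolding y_def using nz(1) by (metis nonzero_mult_div_cancel_right times_divide_eq_left)
    finally show ?thesis .
  qed
qed

text \<open>An expansion in the nome already contains holomorphy and invariance under translations,
  so the inversion is all that is left to check.\<close>

lemma modular_forms_iff:
  assumes "even k"
  shows "f \<in> modular_forms k \<longleftrightarrow>
    (\<forall>z. z \<notin> upper_half_plane \<longrightarrow> f z = 0) \<and> (\<exists>F. has_q_expansion f F) \<and>
    (\<forall>z\<in>upper_half_plane. f (- 1 / z) = z powi k * f z)" (is "?L \<longleftrightarrow> ?R")
proof
  assume L: ?L
  have "f (- 1 / z) = z powi k * f z" if "z \<in> upper_half_plane" for z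
  proof -
    have "\<forall>a b c d :: int. a * d - b * c = 1 \<longrightarrow>
        f ((of_int a * z + of_int b) / (of_int c * z + of_int d)) = (of_int c * z + of_int d) powi k * f z"
      using L that by (simp add: modular_forms_def)
    \<comment> \<open>The arguments come in the order \<open>a\<close>, \<open>d\<close>,
      \<open>b\<close>, \<open>c\<close> of the determinant, so this is the matrix with rows
      \<open>(0, - 1)\<close> and \<open>(1, 0)\<close>.\<close>
    from this[rule_format, of 0 0 "- 1" 1] show ?thesis
      by simp
  qed
  with L show ?R
    by (auto simp: modular_forms_def)
next
  assume R: ?R
  then obtain F where F: "has_q_expansion f F"
    by blast
  show ?L
    unfolding modular_forms_def
    using R q_expansion_holomorphic[OF F] modular_transformation_from_generators[OF F assms] by blast
qed

lemma modular_form_inversion: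
  assumes "f \<in> modular_forms k" "even k" "z \<in> upper_half_plane"
  shows "f (- 1 / z) = z powi k * f z"
  using assms by (simp add: modular_forms_iff)

lemma modular_form_q_expansion:
  assumes "f \<in> modular_forms k"
  obtains F where "has_q_expansion f F"
  using assms by (auto simp: modular_forms_def)

lemma modular_form_outside: "f \<in> modular_forms k \<Longrightarrow> z \<notin> upper_half_plane \<Longrightarrow> f z = 0"
  by (simp add: modular_forms_def)

lemma modular_forms_add:
  assumes "f \<in> modular_forms k" "g \<in> modular_forms k" "even k"
  shows "(\<lambda>z. f z + g z) \<in> modular_forms k"
  using assms unfolding modular_forms_iff[OF assms(3)]
  by (auto simp: algebra_simps intro: q_expansion_add)

lemma modular_forms_scale:
  assumes "f \<in> modular_forms k" "even k"
  shows "(\<lambda>z. c * f z) \<in> modular_forms k"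
  using assms unfolding modular_forms_iff[OF assms(2)]
  by (auto simp: algebra_simps intro: q_expansion_scale)

lemma modular_forms_diff:
  assumes "f \<in> modular_forms k" "g \<in> modular_forms k" "even k"
  shows "(\<lambda>z. f z - g z) \<in> modular_forms k"
  using modular_forms_add[OF assms(1) modular_forms_scale[OF assms(2), of "- 1"]] assms(3) by simp

lemma modular_forms_mult:
  assumes "f \<in> modular_forms k" "g \<in> modular_forms l" "even k" "even l"
  shows "(\<lambda>z. f z * g z) \<in> modular_forms (k + l)"
proof -
  have "even (k + l)"
    using assms by simp
  then show ?thesis
    using assms unfolding modular_forms_iff[OF assms(3)] modular_forms_iff[OF assms(4)]
    by (auto simp: modular_forms_iff power_int_add upper_half_plane_nonzero intro: q_expansion_mult)
qed

lemma modular_forms_zero: "even k \<Longrightarrow> (\<lambda>z. 0) \<in> modular_forms k"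
  using q_expansion_const[of 0] by (auto simp: modular_forms_iff)

lemma modular_forms_one: "(\<lambda>z. if z \<in> upper_half_plane then 1 else 0) \<in> modular_forms 0"
proof -
  have "has_q_expansion (\<lambda>z. if z \<in> upper_half_plane then 1 else 0) (fps_const 1)"
    by (rule q_expansion_cong[OF q_expansion_const]) simp
  then show ?thesis
    using upper_half_plane_inversion by (auto simp: modular_forms_iff)
qed

lemma eisenstein_outside: "z \<notin> upper_half_plane \<Longrightarrow> eisenstein k z = 0"
  by (simp add: eisenstein_def)

lemma modular_forms_eisenstein:
  "eisenstein 4 \<in> modular_forms 4" "eisenstein 6 \<in> modular_forms 6"
  using eisenstein_q_expansion eisenstein_inversion(2,3) by (auto simp: modular_forms_iff eisenstein_outside)

section \<open>Derivatives of modular forms\<close>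

lemma normalized_deriv_inversion:
  assumes f: "has_q_expansion f F" and z: "z \<in> upper_half_plane"
    and g: "\<And>z. z \<in> upper_half_plane \<Longrightarrow> f (- 1 / z) = g z"
    and g': "(g has_field_derivative g') (at z)"
  shows "normalized_deriv f (- 1 / z) = z\<^sup>2 * g' / (2 * of_real pi * \<i>)"
proof -
  have z0: "z \<noteq> 0"
    using z by (rule upper_half_plane_nonzero)
  have w: "- 1 / z \<in> upper_half_plane"
    using z by (rule upper_half_plane_inversion)
  have "(f has_field_derivative deriv f (- 1 / z)) (at (- 1 / z))"
    using q_expansion_has_field_derivative[OF f w] DERIV_imp_deriv by metis
  moreover have "((\<lambda>z. - 1 / z) has_field_derivative 1 / z\<^sup>2) (at z)"
    using z0 by (auto intro!: derivative_eq_intros simp: power2_eq_square)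
  ultimately have "((\<lambda>z. f (- 1 / z)) has_field_derivative deriv f (- 1 / z) * (1 / z\<^sup>2)) (at z)"
    by (rule DERIV_chain2)
  moreover have "eventually (\<lambda>z. f (- 1 / z) = g z) (nhds z)"
    using eventually_nhds_in_open[OF open_upper_half_plane z] by eventually_elim (rule g)
  ultimately have "(g has_field_derivative deriv f (- 1 / z) * (1 / z\<^sup>2)) (at z)"
    by (rule iffD1[OF DERIV_cong_ev[OF refl _ refl], rotated])
  with g' have "g' = deriv f (- 1 / z) * (1 / z\<^sup>2)"
    using DERIV_unique by blast
  with w z0 show ?thesis
    by (simp add: normalized_deriv_def)
qed

lemma normalized_deriv_outside: "z \<notin> upper_half_plane \<Longrightarrow> normalized_deriv f z = 0"
  by (simp add: normalized_deriv_def)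

lemma serre_deriv_outside: "z \<notin> upper_half_plane \<Longrightarrow> serre_deriv k f z = 0"
  by (simp add: serre_deriv_def normalized_deriv_def eisenstein_outside)

definition serre_fps :: "int \<Rightarrow> complex fps \<Rightarrow> complex fps" where
  "serre_fps k F = fps_X * fps_deriv F - fps_const (of_int k / 12) * (eisenstein_fps 2 * F)"

lemma serre_q_expansion:
  assumes "has_q_expansion f F"
  shows "has_q_expansion (serre_deriv k f) (serre_fps k F)"
proof -
  have "has_q_expansion (\<lambda>z. normalized_deriv f z - of_int k / 12 * (eisenstein 2 z * f z)) (serre_fps k F)"
    unfolding serre_fps_def
    by (intro q_expansion_diff q_expansion_deriv q_expansion_scale q_expansion_mult eisenstein_q_expansion assms)
  then show ?thesis
    by (rule q_expansion_cong) (simp add: serre_deriv_def)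
qed

text \<open>Differentiating the factor \<open>z powi k\<close> leaves the anomaly
  \<open>k z^(k+1) f / (2 \<pi> \<i>)\<close>, and \<open>k / 12\<close> times the anomaly
  \<open>6 z / (\<pi> \<i>)\<close> of \<open>E\<^sub>2\<close> removes it.\<close>

lemma modular_forms_serre_deriv:
  assumes f: "f \<in> modular_forms k" and k: "even k"
  shows "serre_deriv k f \<in> modular_forms (k + 2)"
proof -
  obtain F where F: "has_q_expansion f F"
    using f by (rule modular_form_q_expansion)
  have "serre_deriv k f (- 1 / z) = z powi (k + 2) * serre_deriv k f z" if z: "z \<in> upper_half_plane" for z
  proof -
    have z0: "z \<noteq> 0"
      using z by (rule upper_half_plane_nonzero)
    have "(f has_field_derivative deriv f z) (at z)"
      using q_expansion_has_field_derivative[OF F z] DERIV_imp_deriv by metis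
    moreover have "((\<lambda>z. z powi k) has_field_derivative of_int k * z powi (k - 1)) (at z)"
      using z0 by (auto intro!: derivative_eq_intros)
    ultimately have "((\<lambda>z. z powi k * f z) has_field_derivative
        (of_int k * z powi (k - 1) * f z + deriv f z * z powi k)) (at z)"
      by (intro DERIV_mult)
    from normalized_deriv_inversion[OF F z modular_form_inversion[OF f k] this]
    have step: "normalized_deriv f (- 1 / z) =
        z\<^sup>2 * (of_int k * (z powi k / z) * f z + deriv f z * z powi k) / (2 * of_real pi * \<i>)"
      using z0 by (simp add: power_int_diff)
    have deriv: "deriv f z = 2 * of_real pi * \<i> * normalized_deriv f z"
      using z by (simp add: normalized_deriv_def)
    have step2: "normalized_deriv f (- 1 / z) =
        z\<^sup>2 * z powi k * normalized_deriv f z + of_int k * z * z powi k * f z / (2 * of_real pi * \<i>)"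
      unfolding step deriv using z0 by (simp add: field_simps power2_eq_square)
    show ?thesis
      using z0 unfolding serre_deriv_def step2 eisenstein_inversion(1)[OF z] modular_form_inversion[OF f k z]
      by (simp add: power_int_add power2_eq_square divide_simps) (simp add: algebra_simps)
  qed
  moreover have "even (k + 2)"
    using k by simp
  ultimately show ?thesis
    using serre_q_expansion[OF F] by (auto simp: modular_forms_iff serre_deriv_outside)
qed

text \<open>Under inversion the derivative acquires \<open>z^3 E\<^sub>2 / (\<pi> \<i>)\<close> and
  \<open>3 z^2 / (\<pi> \<i>)^2\<close>; the factor 1 / 12 makes the square acquire the same two
  terms.\<close>

lemma modular_form_E2_riccati:
  "(\<lambda>z. normalized_deriv (eisenstein 2) z - eisenstein 2 z ^ 2 / 12) \<in> modular_forms 4" (is "?f \<in> _")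
proof -
  note F = eisenstein_q_expansion[of 2]
  have "?f (- 1 / z) = z ^ 4 * ?f z" if z: "z \<in> upper_half_plane" for z
  proof -
    have z0: "z \<noteq> 0"
      using z by (rule upper_half_plane_nonzero)
    have "(eisenstein 2 has_field_derivative deriv (eisenstein 2) z) (at z)"
      using q_expansion_has_field_derivative[OF F z] DERIV_imp_deriv by metis
    then have "((\<lambda>z. z\<^sup>2 * eisenstein 2 z + 6 * z / (of_real pi * \<i>)) has_field_derivative
        (2 * z * eisenstein 2 z + deriv (eisenstein 2) z * z\<^sup>2 + 6 / (of_real pi * \<i>))) (at z)"
      by (auto intro!: derivative_eq_intros)
    from normalized_deriv_inversion[OF F z eisenstein_inversion(1) this]
    have step: "normalized_deriv (eisenstein 2) (- 1 / z) =
        z\<^sup>2 * (2 * z * eisenstein 2 z + deriv (eisenstein 2) z * z\<^sup>2 + 6 / (of_real pi * \<i>)) / (2 * of_real pi * \<i>)" .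
    have deriv: "deriv (eisenstein 2) z = 2 * of_real pi * \<i> * normalized_deriv (eisenstein 2) z"
      using z by (simp add: normalized_deriv_def)
    have step2: "normalized_deriv (eisenstein 2) (- 1 / z) = z ^ 4 * normalized_deriv (eisenstein 2) z
        + z ^ 3 * eisenstein 2 z / (of_real pi * \<i>) + 3 * z\<^sup>2 / (of_real pi * \<i>)\<^sup>2"
      unfolding step deriv using z0 by (simp add: field_simps power_numeral_reduce)
    show ?thesis
      unfolding step2 eisenstein_inversion(1)[OF z]
      by (simp add: divide_simps power_numeral_reduce) (simp add: algebra_simps)
  qed
  moreover have "has_q_expansion ?f (fps_X * fps_deriv (eisenstein_fps 2) - fps_const (1 / 12) * eisenstein_fps 2 ^ 2)"
    using q_expansion_diff[OF q_expansion_deriv[OF F] q_expansion_scale[OF q_expansion_power[OF F, of 2], of "1 / 12"]]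
    by simp
  ultimately show ?thesis
    by (auto simp: modular_forms_iff eisenstein_outside normalized_deriv_outside)
qed


subsection \<open>The valence bound\<close>

text \<open>\<open>log_delta z\<close> is a logarithm of the modular discriminant, so that the discriminant has no
  zeros by construction.\<close>

definition log_delta_fps :: "complex fps" where
  "log_delta_fps = Abs_fps (\<lambda>n. - 24 * of_nat (divisor_sigma 1 n) / of_nat n)"

definition log_delta :: "complex \<Rightarrow> complex" where
  "log_delta z = 2 * of_real pi * \<i> * z + eval_fps log_delta_fps (nome z)"

text \<open>For positive index the coefficients are those of \<open>E\<^sub>2\<close> divided by the
  index, hence dominated by them.\<close>

lemma log_delta_q_expansion:
  "has_q_expansion (\<lambda>z. eval_fps log_delta_fps (nome z)) log_delta_fps"
proof -
  have "1 \<le> fps_conv_radius log_delta_fps"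
    unfolding fps_conv_radius_def
  proof (rule conv_radius_geI_ex')
    fix r :: real assume r: "0 < r" "ereal r < 1"
    have "ereal (norm (complex_of_real r)) < fps_conv_radius (eisenstein_fps 2)"
      using r q_expansion_radius_ge_1[OF eisenstein_q_expansion, of 2] less_le_trans[of "ereal r" 1] by simp
    then have "summable (\<lambda>n. norm (fps_nth (eisenstein_fps 2) n * of_real r ^ n))"
      by (rule norm_summable_fps)
    then show "summable (\<lambda>n. fps_nth log_delta_fps n * complex_of_real r ^ n)"
    proof (rule summable_comparison_test')
      fix n :: nat
      have "norm (fps_nth log_delta_fps n) \<le> norm (fps_nth (eisenstein_fps 2) n)"
      proof (cases n)
        case (Suc m)
        have "divisor_sigma 1 n * 1 \<le> divisor_sigma 1 n * n"
          by (rule mult_le_mono2) (simp add: Suc)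
        then have "real (divisor_sigma 1 n) \<le> real (divisor_sigma 1 n) * real n"
          unfolding of_nat_mult[symmetric] of_nat_le_iff by simp
        with Suc show ?thesis
          by (simp add: log_delta_fps_def eisenstein_fps_def bernoulli_values norm_mult norm_divide
              norm_of_nat divide_le_eq del: of_nat_Suc)
      qed (simp add: log_delta_fps_def)
      then show "norm (fps_nth log_delta_fps n * complex_of_real r ^ n)
          \<le> norm (fps_nth (eisenstein_fps 2) n * of_real r ^ n)"
        by (simp add: norm_mult mult_right_mono)
    qed
  qed
  then show ?thesis
    by (simp add: has_q_expansion_iff)
qed

text \<open>The series of \<open>log_delta\<close> is \<open>E\<^sub>2\<close> integrated term by
  term, its constant term 1 giving the linear part.\<close>

lemma log_delta_has_field_derivative:
  assumes "z \<in> upper_half_plane"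
  shows "(log_delta has_field_derivative 2 * of_real pi * \<i> * eisenstein 2 z) (at z)"
proof -
  have "fps_X * fps_deriv log_delta_fps = eisenstein_fps 2 - 1"
  proof (rule fps_ext)
    fix n
    show "fps_nth (fps_X * fps_deriv log_delta_fps) n = fps_nth (eisenstein_fps 2 - 1) n"
      by (cases n) (auto simp: log_delta_fps_def eisenstein_fps_def bernoulli_values simp del: of_nat_Suc)
  qed
  moreover have "eval_fps (eisenstein_fps 2 - 1) (nome z) = eisenstein 2 z - 1"
    using q_expansion_radius[OF eisenstein_q_expansion assms, of 2]
      q_expansion_eq[OF eisenstein_q_expansion assms, of 2]
    by (simp add: eval_fps_diff)
  ultimately have "((\<lambda>z. eval_fps log_delta_fps (nome z)) has_field_derivative
      2 * of_real pi * \<i> * (eisenstein 2 z - 1)) (at z)"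
    using q_expansion_has_field_derivative[OF log_delta_q_expansion assms] by simp
  then show ?thesis
    unfolding log_delta_def[abs_def]
    by (rule DERIV_cong[OF DERIV_add, rotated]) (auto intro!: derivative_eq_intros simp: algebra_simps)
qed

lemma exp_log_delta_add_1: "exp (log_delta (z + 1)) = exp (log_delta z)"
proof -
  have "exp (log_delta z) = nome z * exp (eval_fps log_delta_fps (nome z))" for z
    by (simp add: log_delta_def exp_add nome_def)
  then show ?thesis
    by (simp add: nome_add)
qed

text \<open>By the inversion law of \<open>E\<^sub>2\<close> the logarithmic derivatives of the two
  sides agree, the anomaly contributing exactly \<open>12 / z\<close>. So the quotient is constant,
  and a single point determines it.\<close>

lemma exp_log_delta_inversion:
  assumes z: "z \<in> upper_half_plane"
  shows "exp (log_delta (- 1 / z)) = z ^ 12 * exp (log_delta z)"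
proof -
  define h where "h = (\<lambda>z. exp (log_delta (- 1 / z) - log_delta z) / z ^ 12)"
  have "(h has_field_derivative 0) (at z)" if z: "z \<in> upper_half_plane" for z
  proof -
    have z0: "z \<noteq> 0"
      using z by (rule upper_half_plane_nonzero)
    have "((\<lambda>z. - 1 / z) has_field_derivative 1 / z\<^sup>2) (at z)"
      using z0 by (auto intro!: derivative_eq_intros simp: power2_eq_square)
    from DERIV_chain2[OF log_delta_has_field_derivative[OF upper_half_plane_inversion[OF z]] this]
    have "((\<lambda>z. log_delta (- 1 / z)) has_field_derivative
        2 * of_real pi * \<i> * eisenstein 2 (- 1 / z) * (1 / z\<^sup>2)) (at z)" .
    also have "2 * of_real pi * \<i> * eisenstein 2 (- 1 / z) * (1 / z\<^sup>2) =
        2 * of_real pi * \<i> * eisenstein 2 z + 12 / z"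
      unfolding eisenstein_inversion(1)[OF z] using z0 by (simp add: field_simps power2_eq_square)
    finally have "((\<lambda>z. log_delta (- 1 / z) - log_delta z) has_field_derivative
        2 * of_real pi * \<i> * eisenstein 2 z + 12 / z - 2 * of_real pi * \<i> * eisenstein 2 z) (at z)"
      by (intro DERIV_diff log_delta_has_field_derivative[OF z])
    then have "((\<lambda>z. log_delta (- 1 / z) - log_delta z) has_field_derivative 12 / z) (at z)"
      by simp
    moreover have "((\<lambda>z. z ^ 12) has_field_derivative 12 * z ^ 11) (at z)"
      by (auto intro!: derivative_eq_intros)
    ultimately have "(h has_field_derivative
        (exp (log_delta (- 1 / z) - log_delta z) * (12 / z) * z ^ 12 -
          exp (log_delta (- 1 / z) - log_delta z) * (12 * z ^ 11)) / (z ^ 12 * z ^ 12)) (at z)"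
      unfolding h_def using z0 by (intro DERIV_divide DERIV_chain2[OF DERIV_exp]) auto
    moreover have "(12 / z) * z ^ 12 = 12 * z ^ 11"
      using z0 by (simp add: power_numeral_reduce)
    ultimately show ?thesis
      by (simp only: mult.assoc diff_self div_0)
  qed
  then have "h constant_on upper_half_plane"
    using open_upper_half_plane connected_upper_half_plane
    by (intro DERIV_zero_connected_constant_on[of upper_half_plane "{}"])
      (auto intro!: DERIV_continuous_on[where D = "\<lambda>_. 0"] intro: has_field_derivative_at_within)
  then have "h z = h \<i>"
    using z by (auto simp: constant_on_def upper_half_plane_iff)
  \<comment> \<open>The point \<i> is fixed by the inversion, and its twelfth power is 1.\<close>
  also have "h \<i> = 1"
    by (simp add: h_def field_simps power_numeral_reduce)
  finally show ?thesis
    using upper_half_plane_nonzero[OF z] by (simp add: h_def exp_diff field_simps)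
qed

text \<open>Each inversion at least doubles the imaginary part of a point with \<open>\<bar>Re z\<bar> \<le> 1/2\<close> and
  \<open>Im z < 1/2\<close>.\<close>

lemma reduce_to_strip:
  assumes z: "z \<in> upper_half_plane"
    and translation: "\<And>z. z \<in> upper_half_plane \<Longrightarrow> f (z + 1) = f z"
    and inversion: "\<And>z. z \<in> upper_half_plane \<Longrightarrow> f (- 1 / z) = f z"
  obtains y where "\<bar>Re y\<bar> \<le> 1 / 2" "1 / 2 \<le> Im y" "f y = f z"
proof -
  have translation_nat: "f (z + of_nat n) = f z" if "z \<in> upper_half_plane" for z n
  proof (induction n)
    case (Suc n)
    have "z + of_nat n \<in> upper_half_plane"
      using that by (simp add: upper_half_plane_iff)
    from translation[OF this] Suc show ?case
      by (simp add: add_ac)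
  qed auto
  have translation_int: "f (z + of_int n) = f z" if "z \<in> upper_half_plane" for z n
  proof (cases n)
    case (neg m)
    then have "z + of_int n \<in> upper_half_plane"
      using that by (simp add: upper_half_plane_iff)
    from translation_nat[OF this, of "Suc m"] neg show ?thesis
      by simp
  qed (use translation_nat that in auto)
  have strip: "\<exists>y. \<bar>Re y\<bar> \<le> 1 / 2 \<and> Im y = Im z \<and> f y = f z" if "z \<in> upper_half_plane" for z
  proof (intro exI conjI)
    let ?y = "z + of_int (- round (Re z))"
    show "\<bar>Re ?y\<bar> \<le> 1 / 2"
      using of_int_round_abs_le[of "Re z"] by (simp add: abs_minus_commute)
    show "f ?y = f z"
      using that by (rule translation_int)
  qed simp
  have "\<exists>y. \<bar>Re y\<bar> \<le> 1 / 2 \<and> 1 / 2 \<le> Im y \<and> f y = f z"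
    if "z \<in> upper_half_plane" "(1 / 2) ^ Suc n \<le> Im z" for n z
    using that
  proof (induction n arbitrary: z)
    case 0
    then show ?case
      using strip[of z] by auto
  next
    case (Suc n)
    obtain y where y: "\<bar>Re y\<bar> \<le> 1 / 2" "Im y = Im z" "f y = f z"
      using strip Suc.prems(1) by blast
    have y_up: "y \<in> upper_half_plane"
      using y Suc.prems(1) by (simp add: upper_half_plane_iff)
    show ?case
    proof (cases "1 / 2 \<le> Im y")
      case False
      have "(Re y)\<^sup>2 \<le> (1 / 2)\<^sup>2" "(Im y)\<^sup>2 \<le> (1 / 2)\<^sup>2"
        using y(1) False y_up by (auto simp: abs_le_square_iff[symmetric] upper_half_plane_iff)
      then have "(norm y)\<^sup>2 \<le> 1 / 2"
        unfolding cmod_power2 by (simp add: power2_eq_square)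
      then have "2 * Im y \<le> Im y / (norm y)\<^sup>2"
        using y_up upper_half_plane_nonzero[OF y_up]
        by (simp add: pos_le_divide_eq upper_half_plane_iff)
      then have "(1 / 2) ^ Suc n \<le> Im (- 1 / y)"
        unfolding Im_inversion using Suc.prems(2) y(2) by (simp only: power_Suc)
      from Suc.IH[OF upper_half_plane_inversion[OF y_up] this] show ?thesis
        using inversion[OF y_up] y(3) by simp
    qed (use y in blast)
  qed
  moreover obtain n where "(1 / 2) ^ n < Im z"
    using real_arch_pow_inv[of "Im z" "1 / 2"] z by (auto simp: upper_half_plane_iff)
  moreover have "(1 / 2 :: real) ^ Suc n \<le> (1 / 2) ^ n" for n
    by simp
  ultimately show ?thesis
    using z that by (meson less_eq_real_def order_trans)
qed

text \<open>Decay at the cusp and reduction to the strip confine the large values to a compact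
  rectangle, so the norm attains a global maximum. The function is then constant, and the decay
  makes it 0.\<close>

lemma invariant_function_vanishes:
  assumes holo: "f holomorphic_on upper_half_plane"
    and translation: "\<And>z. z \<in> upper_half_plane \<Longrightarrow> f (z + 1) = f z"
    and inversion: "\<And>z. z \<in> upper_half_plane \<Longrightarrow> f (- 1 / z) = f z"
    and cusp: "\<And>e. e > 0 \<Longrightarrow> \<exists>Y. \<forall>z. Im z > Y \<longrightarrow> norm (f z) < e"
    and z: "z \<in> upper_half_plane"
  shows "f z = 0"
proof (rule ccontr)
  assume nz: "f z \<noteq> 0"
  then obtain Y where Y: "\<And>y. Im y > Y \<Longrightarrow> norm (f y) < norm (f z)"
    using cusp[of "norm (f z)"] by auto
  define K where "K = cbox (Complex (- 1 / 2) (1 / 2)) (Complex (1 / 2) Y)"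
  have K: "y \<in> K \<longleftrightarrow> \<bar>Re y\<bar> \<le> 1 / 2 \<and> 1 / 2 \<le> Im y \<and> Im y \<le> Y" for y
    by (auto simp: K_def in_cbox_complex_iff)
  \<comment> \<open>A value at least as large as \<open>f z\<close> in norm is taken in
    \<open>K\<close>: the reduced point has imaginary part at most \<open>Y\<close>, as values above
    are smaller.\<close>
  have rep: "\<exists>y\<in>K. f y = f x" if x: "x \<in> upper_half_plane" "norm (f z) \<le> norm (f x)" for x
  proof -
    obtain y where y: "\<bar>Re y\<bar> \<le> 1 / 2" "1 / 2 \<le> Im y" "f y = f x"
      using reduce_to_strip[OF x(1) translation inversion] by blast
    moreover have "Im y \<le> Y"
      using Y[of y] y(3) x(2) by fastforce
    ultimately show ?thesis
      using K by auto
  qed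
  have "K \<subseteq> upper_half_plane"
    by (auto simp: K upper_half_plane_iff)
  then have "continuous_on K (\<lambda>y. norm (f y))"
    using holo by (intro continuous_on_norm holomorphic_on_imp_continuous_on) (rule holomorphic_on_subset)
  moreover have "compact K"
    by (simp add: K_def)
  moreover have "K \<noteq> {}"
    using rep[OF z] by auto
  ultimately obtain x where x: "x \<in> K" "\<And>y. y \<in> K \<Longrightarrow> norm (f y) \<le> norm (f x)"
    using continuous_attains_sup by metis
  have zx: "norm (f z) \<le> norm (f x)"
    using rep[OF z] x(2) by fastforce
  have "f constant_on upper_half_plane"
  proof (rule maximum_modulus_principle[OF holo open_upper_half_plane connected_upper_half_plane
        open_upper_half_plane order_refl])
    show "x \<in> upper_half_plane"
      using x(1) \<open>K \<subseteq> upper_half_plane\<close> by blast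
    show "norm (f y) \<le> norm (f x)" if "y \<in> upper_half_plane" for y
      using rep[OF that] x(2) zx by fastforce
  qed
  \<comment> \<open>A point above \<open>Y\<close>, where the constant value would have to be
    smaller than itself.\<close>
  moreover have "Complex 0 (max 1 (Y + 1)) \<in> upper_half_plane"
    by (simp add: upper_half_plane_iff)
  ultimately have "f (Complex 0 (max 1 (Y + 1))) = f z"
    using z unfolding constant_on_def by metis
  moreover have "norm (f (Complex 0 (max 1 (Y + 1)))) < norm (f z)"
    by (rule Y) simp
  ultimately show False
    by simp
qed

text \<open>The discriminant has weight 12 and order 1 at the cusp, so
  \<open>f^12 / \<Delta>^k\<close> has weight 0 and behaves like \<open>q^(12 n - k)\<close> times a
  bounded function.\<close>

theorem modular_form_vanishes:
  assumes f: "f \<in> modular_forms (int k)" and k: "even k" and F: "has_q_expansion f F"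
    and order: "\<And>i. i < n \<Longrightarrow> fps_nth F i = 0" and n: "k < 12 * n"
    and z: "z \<in> upper_half_plane"
  shows "f z = 0"
proof -
  define h where "h = (\<lambda>z. f z ^ 12 / exp (log_delta z) ^ k)"
  obtain g where g: "has_q_expansion g (fps_shift n F)"
    "\<And>z. z \<in> upper_half_plane \<Longrightarrow> f z = nome z ^ n * g z"
    using q_expansion_factor[OF F order] by blast
  have "h z = 0"
  proof (rule invariant_function_vanishes[OF _ _ _ _ z])
    have "log_delta holomorphic_on upper_half_plane"
      using log_delta_has_field_derivative by (subst holomorphic_on_open[OF open_upper_half_plane]) blast
    then show "h holomorphic_on upper_half_plane"
      unfolding h_def by (intro holomorphic_intros q_expansion_holomorphic[OF F]) auto
  next
    fix z assume z: "z \<in> upper_half_plane"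
    show "h (z + 1) = h z"
      unfolding h_def exp_log_delta_add_1 q_expansion_periodic[OF F z] ..
    have "(z ^ k * f z) ^ 12 / (z ^ 12 * exp (log_delta z)) ^ k =
        (z ^ (12 * k) * f z ^ 12) / (z ^ (12 * k) * exp (log_delta z) ^ k)"
      by (simp add: power_mult_distrib mult.commute flip: power_mult)
    also have "\<dots> = h z"
      using upper_half_plane_nonzero[OF z] by (simp add: h_def)
    finally show "h (- 1 / z) = h z"
      unfolding h_def exp_log_delta_inversion[OF z] using modular_form_inversion[OF f _ z] k by simp
  next
    fix e :: real assume "e > 0"
    let ?L = "\<lambda>z. eval_fps log_delta_fps (nome z)"
    obtain Y1 where Y1: "\<And>z. Im z > Y1 \<Longrightarrow> norm (?L z - fps_nth log_delta_fps 0) < 1"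
      using q_expansion_tendsto[OF log_delta_q_expansion zero_less_one] by blast
    obtain Y2 where Y2: "\<And>z. Im z > Y2 \<Longrightarrow> norm (g z - fps_nth (fps_shift n F) 0) < 1"
      using q_expansion_tendsto[OF g(1) zero_less_one] by blast
    \<comment> \<open>High in the half-plane \<open>g\<close> and \<open>?L\<close> are within 1 of
      their limits, and the limit of \<open>?L\<close> is 0.\<close>
    define C where "C = (norm (fps_nth F n) + 1) ^ 12 * exp (real k)"
    have C: "C > 0"
      unfolding C_def by (intro mult_pos_pos zero_less_power add_nonneg_pos) auto
    have "has_q_expansion nome fps_X"
      by (simp add: has_q_expansion_iff)
    from q_expansion_tendsto[OF this, of "e / C"] C \<open>e > 0\<close>
    obtain Y3 where Y3: "\<And>z. Im z > Y3 \<Longrightarrow> norm (nome z) < e / C"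
      by auto
    show "\<exists>Y. \<forall>z. Im z > Y \<longrightarrow> norm (h z) < e"
    proof (intro exI allI impI)
      fix z assume Im: "Im z > Max {0, Y1, Y2, Y3}"
      then have z: "z \<in> upper_half_plane"
        by (simp add: upper_half_plane_iff)
      have "norm (?L z) \<le> 1"
        using Y1[of z] Im by (simp add: log_delta_fps_def)
      then have "- Re (?L z) \<le> 1"
        using abs_Re_le_cmod[of "?L z"] by linarith
      then have "norm (exp (- of_nat k * ?L z)) \<le> exp (real k)"
        using mult_left_mono[of "- Re (?L z)" 1 "real k"] by (simp add: norm_exp_eq_Re)
      moreover have "norm (g z) \<le> norm (fps_nth F n) + 1"
        using Y2[of z] Im norm_triangle_ineq2[of "g z" "fps_nth F n"] by simp
      ultimately have bound: "norm (g z ^ 12 * exp (- of_nat k * ?L z)) \<le> C"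
        unfolding C_def norm_mult norm_power by (intro mult_mono power_mono) auto
      have "exp (log_delta z) ^ k = nome z ^ k * exp (of_nat k * ?L z)"
        by (simp add: log_delta_def exp_add nome_def power_mult_distrib exp_of_nat_mult)
      then have "h z = nome z ^ (n * 12) / nome z ^ k * (g z ^ 12 * exp (- of_nat k * ?L z))"
        unfolding h_def g(2)[OF z]
        by (simp add: power_mult_distrib exp_minus divide_inverse mult_ac flip: power_mult)
      also have "nome z ^ (n * 12) / nome z ^ k = nome z ^ (n * 12 - k)"
        using n by (simp add: power_diff)
      finally have "norm (h z) \<le> norm (nome z) ^ (n * 12 - k) * C"
        using mult_left_mono[OF bound, of "norm (nome z) ^ (n * 12 - k)"] by (simp add: norm_mult norm_power)
      \<comment> \<open>The hypothesis leaves at least one factor of the nome, which is enough for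
        decay.\<close>
      also have "\<dots> \<le> norm (nome z) ^ 1 * C"
        using n C z norm_nome_less_1_iff[of z]
        by (intro mult_right_mono power_decreasing) (auto simp: upper_half_plane_iff)
      also have "\<dots> < e"
        using Y3[of z] Im C by (simp add: pos_less_divide_eq)
      finally show "norm (h z) < e" .
    qed
  qed
  then show ?thesis
    by (simp add: h_def)
qed

subsection \<open>Quasimodular forms of depth 1\<close>

lemma q_expansion_field_differentiable:
  "has_q_expansion f F \<Longrightarrow> z \<in> upper_half_plane \<Longrightarrow> f field_differentiable (at z)"
  using q_expansion_holomorphic open_upper_half_plane holomorphic_on_imp_differentiable_at by blast

lemma normalized_deriv_add:
  assumes "has_q_expansion f F" "has_q_expansion g G"
  shows "normalized_deriv (\<lambda>z. f z + g z) z = normalized_deriv f z + normalized_deriv g z"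
  using assms by (auto simp: normalized_deriv_def add_divide_distrib q_expansion_field_differentiable)

lemma normalized_deriv_mult:
  assumes "has_q_expansion f F" "has_q_expansion g G"
  shows "normalized_deriv (\<lambda>z. f z * g z) z = normalized_deriv f z * g z + f z * normalized_deriv g z"
  using assms by (auto simp: normalized_deriv_def field_simps deriv_mult q_expansion_field_differentiable)

text \<open>The difference of the two sides is modular of weight 4, below 12, so a vanishing
  constant term is enough.\<close>

proposition ramanujan_E2:
  "normalized_deriv (eisenstein 2) z = (eisenstein 2 z ^ 2 - eisenstein 4 z) / 12"
proof (cases "z \<in> upper_half_plane")
  case True
  let ?f = "\<lambda>z. (normalized_deriv (eisenstein 2) z - eisenstein 2 z ^ 2 / 12) + 1 / 12 * eisenstein 4 z"
  have "?f \<in> modular_forms 4"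
    by (intro modular_forms_add modular_forms_scale modular_form_E2_riccati modular_forms_eisenstein) auto
  then have f: "?f \<in> modular_forms (int 4)"
    by simp
  have "has_q_expansion (\<lambda>z. (normalized_deriv (eisenstein 2) z - 1 / 12 * eisenstein 2 z ^ 2) + 1 / 12 * eisenstein 4 z)
      (fps_X * fps_deriv (eisenstein_fps 2) - fps_const (1 / 12) * eisenstein_fps 2 ^ 2
        + fps_const (1 / 12) * eisenstein_fps 4)" (is "has_q_expansion _ ?F")
    by (intro q_expansion_add q_expansion_diff q_expansion_deriv q_expansion_scale q_expansion_power
        eisenstein_q_expansion)
  then have F: "has_q_expansion ?f ?F"
    by simp
  have "fps_nth ?F 0 = 0"
    by (simp add: eisenstein_fps_nth_0 power2_eq_square)
  then have "?f z = 0"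
    by (intro modular_form_vanishes[OF f _ F, of 1] True) auto
  then show ?thesis
    by (simp add: field_simps add_eq_0_iff)
qed (simp add: normalized_deriv_outside eisenstein_outside)

lemma quasimodular_forms1_iff:
  "f \<in> quasimodular_forms1 w \<longleftrightarrow>
    (\<exists>A\<in>modular_forms w. \<exists>B\<in>modular_forms (w - 2). f = (\<lambda>z. A z + eisenstein 2 z * B z))"
  by (auto simp: quasimodular_forms1_def)

lemma quasimodular_forms1I:
  assumes "A \<in> modular_forms w" "B \<in> modular_forms (w - 2)" "f = (\<lambda>z. A z + eisenstein 2 z * B z)"
  shows "f \<in> quasimodular_forms1 w"
  using assms unfolding quasimodular_forms1_iff by (intro bexI)

lemma quasimodular_q_expansion:
  assumes "f \<in> quasimodular_forms1 w"
  obtains F where "has_q_expansion f F"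
  using assms unfolding quasimodular_forms1_iff
  by (metis modular_form_q_expansion q_expansion_add q_expansion_mult eisenstein_q_expansion)

lemma quasimodular_outside:
  "f \<in> quasimodular_forms1 w \<Longrightarrow> z \<notin> upper_half_plane \<Longrightarrow> f z = 0"
  by (auto simp: quasimodular_forms1_iff eisenstein_outside modular_form_outside)

lemma quasimodular_add:
  assumes "f \<in> quasimodular_forms1 w" "g \<in> quasimodular_forms1 w" "even w"
  shows "(\<lambda>z. f z + g z) \<in> quasimodular_forms1 w"
proof -
  obtain A B where f: "A \<in> modular_forms w" "B \<in> modular_forms (w - 2)"
    "f = (\<lambda>z. A z + eisenstein 2 z * B z)"
    using assms(1) by (auto simp: quasimodular_forms1_iff)
  obtain A' B' where g: "A' \<in> modular_forms w" "B' \<in> modular_forms (w - 2)"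
    "g = (\<lambda>z. A' z + eisenstein 2 z * B' z)"
    using assms(2) by (auto simp: quasimodular_forms1_iff)
  show ?thesis
    unfolding quasimodular_forms1_iff
    by (intro bexI[of _ "\<lambda>z. A z + A' z"] bexI[of _ "\<lambda>z. B z + B' z"] modular_forms_add f g)
      (use assms(3) in \<open>auto simp: f(3) g(3) algebra_simps\<close>)
qed

lemma quasimodular_mult_modular:
  assumes "g \<in> modular_forms k" "f \<in> quasimodular_forms1 w" "even w" "even k"
  shows "(\<lambda>z. g z * f z) \<in> quasimodular_forms1 (w + k)"
proof -
  obtain A B where f: "A \<in> modular_forms w" "B \<in> modular_forms (w - 2)"
    "f = (\<lambda>z. A z + eisenstein 2 z * B z)"
    using assms(2) by (auto simp: quasimodular_forms1_iff)
  have "(\<lambda>z. A z * g z) \<in> modular_forms (w + k)"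
    using modular_forms_mult[OF f(1) assms(1)] assms by simp
  moreover have "(\<lambda>z. B z * g z) \<in> modular_forms (w + k - 2)"
    using modular_forms_mult[OF f(2) assms(1)] assms by (simp add: algebra_simps)
  ultimately show ?thesis
    unfolding quasimodular_forms1_iff
    by (intro bexI[of _ "\<lambda>z. A z * g z"] bexI[of _ "\<lambda>z. B z * g z"]) (auto simp: f(3) algebra_simps)
qed

lemma quasimodular_scale:
  assumes "f \<in> quasimodular_forms1 w" "even w"
  shows "(\<lambda>z. c * f z) \<in> quasimodular_forms1 w"
proof -
  have "(\<lambda>z. (c * (if z \<in> upper_half_plane then 1 else 0)) * f z) \<in> quasimodular_forms1 (w + 0)"
    using assms by (intro quasimodular_mult_modular modular_forms_scale modular_forms_one) auto
  moreover have "(\<lambda>z. (c * (if z \<in> upper_half_plane then 1 else 0)) * f z) = (\<lambda>z. c * f z)"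
    using quasimodular_outside[OF assms(1)] by auto
  ultimately show ?thesis
    by simp
qed

lemma quasimodular_diff:
  assumes "f \<in> quasimodular_forms1 w" "g \<in> quasimodular_forms1 w" "even w"
  shows "(\<lambda>z. f z - g z) \<in> quasimodular_forms1 w"
  using quasimodular_add[OF assms(1) quasimodular_scale[OF assms(2,3), of "- 1"] assms(3)] by simp

text \<open>The parameter is weight minus depth: for \<open>w - 1\<close> the terms in the square of
  \<open>E\<^sub>2\<close> cancel, and depth 1 is preserved.\<close>

lemma quasimodular_serre_deriv:
  assumes f: "f \<in> quasimodular_forms1 w" and w: "even w"
  shows "serre_deriv (w - 1) f \<in> quasimodular_forms1 (w + 2)"
proof -
  obtain A B where AB: "A \<in> modular_forms w" "B \<in> modular_forms (w - 2)"
    "f = (\<lambda>z. A z + eisenstein 2 z * B z)"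
    using f by (auto simp: quasimodular_forms1_iff)
  obtain FA FB where F: "has_q_expansion A FA" "has_q_expansion B FB"
    using AB modular_form_q_expansion by metis
  note E2 = eisenstein_q_expansion[of 2]
  have "(\<lambda>z. serre_deriv w A z - 1 / 12 * (eisenstein 4 z * B z)) \<in> modular_forms (w + 2)"
    using modular_forms_serre_deriv[OF AB(1) w] modular_forms_mult[OF modular_forms_eisenstein(1) AB(2)] w
    by (intro modular_forms_diff modular_forms_scale) (auto simp: add.commute)
  moreover have "(\<lambda>z. 1 / 12 * A z + serre_deriv (w - 2) B z) \<in> modular_forms (w + 2 - 2)"
    using modular_forms_serre_deriv[OF AB(2)] AB(1) w
    by (intro modular_forms_add modular_forms_scale) auto
  moreover have "serre_deriv (w - 1) f = (\<lambda>z. (serre_deriv w A z - 1 / 12 * (eisenstein 4 z * B z)) +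
      eisenstein 2 z * (1 / 12 * A z + serre_deriv (w - 2) B z))"
  proof
    fix z
    have f': "normalized_deriv f z = normalized_deriv A z +
        ((eisenstein 2 z ^ 2 - eisenstein 4 z) / 12 * B z + eisenstein 2 z * normalized_deriv B z)"
      unfolding AB(3) normalized_deriv_add[OF F(1) q_expansion_mult[OF E2 F(2)]]
        normalized_deriv_mult[OF E2 F(2)] ramanujan_E2 ..
    show "serre_deriv (w - 1) f z = (serre_deriv w A z - 1 / 12 * (eisenstein 4 z * B z)) +
        eisenstein 2 z * (1 / 12 * A z + serre_deriv (w - 2) B z)"
      unfolding serre_deriv_def f' by (simp add: AB(3) field_simps power2_eq_square)
  qed
  ultimately show ?thesis
    by (rule quasimodular_forms1I)
qed

section \<open>The vanishing criterion in depth 1\<close>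

lemma fps_mult_nth_vanishing:
  fixes F G :: "'a :: comm_ring_1 fps"
  assumes "\<And>i. i < a \<Longrightarrow> fps_nth F i = 0" "\<And>i. i < b \<Longrightarrow> fps_nth G i = 0"
  shows "i < a + b \<Longrightarrow> fps_nth (F * G) i = 0"
    and "fps_nth (F * G) (a + b) = fps_nth F a * fps_nth G b"
proof -
  have "F = fps_X ^ a * fps_shift a F" "G = fps_X ^ b * fps_shift b G"
    using assms by (auto simp: fps_eq_iff fps_X_power_mult_nth)
  then have *: "F * G = fps_X ^ (a + b) * (fps_shift a F * fps_shift b G)"
    by (metis (no_types, lifting) mult.assoc mult.left_commute power_add)
  show "i < a + b \<Longrightarrow> fps_nth (F * G) i = 0"
    unfolding * by (simp add: fps_X_power_mult_nth)
  show "fps_nth (F * G) (a + b) = fps_nth F a * fps_nth G b"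
    unfolding * by (simp add: fps_X_power_mult_nth)
qed

text \<open>The equation says that \<open>q d/dq\<close> maps \<open>G / F\<close> to the nonzero
  constant \<open>- 1 / c\<close>. The proof avoids the quotient by comparing lowest
  coefficients.\<close>

lemma fps_wronskian_eq_square_imp_0:
  fixes F G :: "complex fps"
  assumes eq: "F ^ 2 = fps_const c * (G * (fps_X * fps_deriv F) - fps_X * fps_deriv G * F)"
    and c: "c \<noteq> 0"
  shows "F = 0"
proof (rule ccontr)
  assume "F \<noteq> 0"
  with eq have "G \<noteq> 0"
    by auto
  define N m where "N = subdegree F" and "m = subdegree G"
  let ?R = "G * (fps_X * fps_deriv F) - fps_X * fps_deriv G * F"
  have nth_theta: "fps_nth (fps_X * fps_deriv H) i = of_nat i * fps_nth H i" for H :: "complex fps" and i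
    by (cases i) auto
  have FN: "fps_nth F N \<noteq> 0" and Gm: "fps_nth G m \<noteq> 0"
    using \<open>F \<noteq> 0\<close> \<open>G \<noteq> 0\<close> by (auto simp: N_def m_def)
  have F0: "fps_nth F i = 0" if "i < N" for i
    using that by (auto simp: N_def)
  have G0: "fps_nth G i = 0" if "i < m" for i
    using that by (auto simp: m_def)
  have F0': "fps_nth (fps_X * fps_deriv F) i = 0" if "i < N" for i
    using that F0 by (simp add: nth_theta)
  have G0': "fps_nth (fps_X * fps_deriv G) i = 0" if "i < m" for i
    using that G0 by (simp add: nth_theta)
  have R_low: "fps_nth ?R i = 0" if "i < m + N" for i
    using fps_mult_nth_vanishing(1)[OF G0 F0' that] fps_mult_nth_vanishing(1)[OF G0' F0 that] by simp
  have R: "fps_nth ?R (m + N) = (of_nat N - of_nat m) * (fps_nth G m * fps_nth F N)"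
    using fps_mult_nth_vanishing(2)[of m G N "fps_X * fps_deriv F", OF G0 F0']
      fps_mult_nth_vanishing(2)[of m "fps_X * fps_deriv G" N F, OF G0' F0]
    by (simp add: nth_theta algebra_simps)
  have L_low: "fps_nth (F ^ 2) i = 0" if "i < N + N" for i
    using fps_mult_nth_vanishing(1)[OF F0 F0 that] by (simp add: power2_eq_square)
  have L: "fps_nth (F ^ 2) (N + N) = fps_nth F N ^ 2"
    using fps_mult_nth_vanishing(2)[of N F N F, OF F0 F0] by (simp add: power2_eq_square)
  \<comment> \<open>For \<open>m < N\<close> the right side has the smaller order
    \<open>m + N\<close>. Otherwise its coefficient of index \<open>2 N\<close> is 0, in case
    \<open>m = N\<close> through the factor \<open>N - m\<close>. The left side has order exactly
    \<open>2 N\<close>.\<close>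
  consider "m < N" | "m \<ge> N"
    by linarith
  then show False
  proof cases
    case 1
    then have "fps_nth ?R (m + N) = 0"
      using L_low[of "m + N"] c unfolding eq by simp
    with R FN Gm 1 show False
      by auto
  next
    case 2
    then have "fps_nth ?R (N + N) = 0"
      using R_low[of "N + N"] R by (cases "m = N") auto
    then have "fps_nth (F ^ 2) (N + N) = 0"
      unfolding eq by simp
    with L FN show False
      by simp
  qed
qed

theorem quasimodular_vanishes:
  assumes f: "f \<in> quasimodular_forms1 (int w)" and w: "even w" and F: "has_q_expansion f F"
    and order: "\<And>i. i < n \<Longrightarrow> fps_nth F i = 0" and n: "w < 6 * n"
  shows "f = (\<lambda>z. 0)"
proof -
  obtain A B where AB: "A \<in> modular_forms (int w)" "B \<in> modular_forms (int w - 2)"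
    "f = (\<lambda>z. A z + eisenstein 2 z * B z)"
    using f by (auto simp: quasimodular_forms1_iff)
  obtain FA FB where FAB: "has_q_expansion A FA" "has_q_expansion B FB"
    using AB modular_form_q_expansion by metis
  note E2 = eisenstein_q_expansion[of 2]
  have w': "even (int w)" "even (int w - 2)" "even (int w + 2)"
    using w by simp_all
  \<comment> \<open>This is \<open>f^2 + 12 (B' f - B f')\<close> after inserting
    \<open>f = A + E\<^sub>2 B\<close> and the differential equation of \<open>E\<^sub>2\<close>:
    all terms with \<open>E\<^sub>2\<close> cancel, and modularity becomes visible.\<close>
  define W where "W = (\<lambda>z. A z * A z + 12 * (A z * serre_deriv (int w - 2) B z - B z * serre_deriv (int w) A z)
    + eisenstein 4 z * (B z * B z))"
  have dB: "serre_deriv (int w - 2) B \<in> modular_forms (int w)"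
    using modular_forms_serre_deriv[OF AB(2)] w' by simp
  have dA: "serre_deriv (int w) A \<in> modular_forms (int w + 2)"
    using modular_forms_serre_deriv[OF AB(1)] w' by simp
  have "(\<lambda>z. A z * A z) \<in> modular_forms (int (2 * w))"
    using modular_forms_mult[OF AB(1) AB(1)] w' by simp
  moreover have "(\<lambda>z. A z * serre_deriv (int w - 2) B z) \<in> modular_forms (int (2 * w))"
    using modular_forms_mult[OF AB(1) dB] w' by simp
  moreover have "(\<lambda>z. B z * serre_deriv (int w) A z) \<in> modular_forms (int (2 * w))"
    using modular_forms_mult[OF AB(2) dA] w' by simp
  moreover have "(\<lambda>z. eisenstein 4 z * (B z * B z)) \<in> modular_forms (int (2 * w))"
    using modular_forms_mult[OF modular_forms_eisenstein(1) modular_forms_mult[OF AB(2) AB(2)]] w' by simp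
  ultimately have W: "W \<in> modular_forms (int (2 * w))"
    unfolding W_def by (intro modular_forms_add modular_forms_diff modular_forms_scale) auto
  let ?G = "F ^ 2 + fps_const 12 * (fps_X * fps_deriv FB * F - FB * (fps_X * fps_deriv F))"
  have "has_q_expansion (\<lambda>z. f z ^ 2 + 12 * (normalized_deriv B z * f z - B z * normalized_deriv f z)) ?G"
    by (intro q_expansion_add q_expansion_diff q_expansion_deriv q_expansion_scale q_expansion_mult
        q_expansion_power F FAB)
  moreover have "f z ^ 2 + 12 * (normalized_deriv B z * f z - B z * normalized_deriv f z) = W z" for z
  proof -
    have f': "normalized_deriv f z = normalized_deriv A z +
        ((eisenstein 2 z ^ 2 - eisenstein 4 z) / 12 * B z + eisenstein 2 z * normalized_deriv B z)"
      unfolding AB(3) normalized_deriv_add[OF FAB(1) q_expansion_mult[OF E2 FAB(2)]]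
        normalized_deriv_mult[OF E2 FAB(2)] ramanujan_E2 ..
    show ?thesis
      unfolding f' by (simp add: W_def AB(3) serre_deriv_def field_simps power2_eq_square)
  qed
  ultimately have G: "has_q_expansion W ?G"
    by simp
  \<comment> \<open>Each product contains \<open>F\<close> or its derivative, so order
    \<open>n\<close> is inherited; in weight \<open>2 w < 12 n\<close> this suffices.\<close>
  have "fps_nth ?G i = 0" if "i < n" for i
  proof -
    have "fps_nth (fps_X * fps_deriv F) i = 0" if "i < n" for i
      using order[OF that] by (cases i) auto
    then show ?thesis
      using that order fps_mult_nth_vanishing(1)[of 0 F n F i] fps_mult_nth_vanishing(1)[of 0 _ n F i]
        fps_mult_nth_vanishing(1)[of 0 FB n "fps_X * fps_deriv F" i]
      by (simp add: power2_eq_square)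
  qed
  then have "W z = 0" if "z \<in> upper_half_plane" for z
    using n that by (intro modular_form_vanishes[OF W _ G, of n]) auto
  then have "has_q_expansion W 0"
    using q_expansion_cong[OF q_expansion_const[of 0], of W] by simp
  then have "?G = 0"
    using G q_expansion_unique by blast
  then have "F ^ 2 = fps_const 12 * (FB * (fps_X * fps_deriv F) - fps_X * fps_deriv FB * F)"
    by (simp add: algebra_simps add_eq_0_iff)
  then have "F = 0"
    by (rule fps_wronskian_eq_square_imp_0) simp
  then show ?thesis
    using F q_expansion_eq_0 quasimodular_outside[OF f] by blast
qed

lemma quasimodular_eqI:
  assumes "f \<in> quasimodular_forms1 (int w)" "g \<in> quasimodular_forms1 (int w)" "even w"
    and "has_q_expansion f F" "has_q_expansion g G" "w < 6 * n"
    and "\<And>i. i < n \<Longrightarrow> fps_nth F i = fps_nth G i"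
  shows "f = g"
proof -
  have "(\<lambda>z. f z - g z) = (\<lambda>z. 0)"
    using assms
    by (intro quasimodular_vanishes[of _ w "F - G" n] quasimodular_diff q_expansion_diff) auto
  then show ?thesis
    by (simp add: fun_eq_iff)
qed

subsection \<open>Extremal forms\<close>

text \<open>Unlike \<open>normalized_extremal1\<close> this leaves the order free and does not refer
  to the dimension, so that forms can be built before the dimension is known.\<close>

definition leading_order :: "nat \<Rightarrow> nat \<Rightarrow> (complex \<Rightarrow> complex) \<Rightarrow> bool" where
  "leading_order w n f \<longleftrightarrow> f \<in> quasimodular_forms1 (int w) \<and>
     (\<exists>F. has_q_expansion f F \<and> (\<forall>i<n. fps_nth F i = 0) \<and> fps_nth F n = 1)"

lemma leading_order_unique:
  assumes "leading_order w n f" "leading_order w n g" "even w" "w < 6 * Suc n"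
  shows "f = g"
proof -
  obtain F G where *: "has_q_expansion f F" "\<forall>i<n. fps_nth F i = 0" "fps_nth F n = 1"
    "has_q_expansion g G" "\<forall>i<n. fps_nth G i = 0" "fps_nth G n = 1"
    using assms(1,2) by (auto simp: leading_order_def)
  show ?thesis
  proof (rule quasimodular_eqI[OF _ _ assms(3) *(1,4) assms(4)])
    show "fps_nth F i = fps_nth G i" if "i < Suc n" for i
      using that * by (auto simp: less_Suc_eq)
  qed (use assms in \<open>auto simp: leading_order_def\<close>)
qed

lemma fps_mult_nth_Suc_vanishing:
  fixes F G :: "'a :: comm_ring_1 fps"
  assumes "\<And>i. i < n \<Longrightarrow> fps_nth F i = 0"
  shows "fps_nth (G * F) (Suc n) = fps_nth G 0 * fps_nth F (Suc n) + fps_nth G 1 * fps_nth F n"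
proof -
  have "F = fps_X ^ n * fps_shift n F"
    using assms by (auto simp: fps_eq_iff fps_X_power_mult_nth)
  then have "G * F = fps_X ^ n * (G * fps_shift n F)"
    by (metis mult.left_commute)
  then have "fps_nth (G * F) (Suc n) = fps_nth (G * fps_shift n F) 1"
    by (simp add: fps_X_power_mult_nth)
  also have "\<dots> = fps_nth G 0 * fps_nth F (Suc n) + fps_nth G 1 * fps_nth F n"
    by (simp add: fps_mult_nth)
  finally show ?thesis .
qed

lemma eisenstein_mult_leading_order:
  assumes "leading_order w n f" "even w" "k = 4 \<or> k = 6"
  shows "leading_order (w + k) n (\<lambda>z. eisenstein k z * f z)"
proof -
  obtain F where F: "has_q_expansion f F" "\<forall>i<n. fps_nth F i = 0" "fps_nth F n = 1"
    using assms(1) by (auto simp: leading_order_def)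
  have "eisenstein k \<in> modular_forms (int k)"
    using assms(3) modular_forms_eisenstein by auto
  then have "(\<lambda>z. eisenstein k z * f z) \<in> quasimodular_forms1 (int (w + k))"
    using quasimodular_mult_modular[of "eisenstein k" "int k" f "int w"] assms by (auto simp: leading_order_def)
  moreover have "fps_nth (eisenstein_fps k * F) i = 0" if "i < n" for i
    using fps_mult_nth_vanishing(1)[of 0 "eisenstein_fps k" n F i] that F by simp
  moreover have "fps_nth (eisenstein_fps k * F) n = 1"
    using fps_mult_nth_vanishing(2)[of 0 "eisenstein_fps k" n F] F eisenstein_fps_nth_0 by simp
  ultimately show ?thesis
    using q_expansion_mult[OF eisenstein_q_expansion F(1), of k] by (auto simp: leading_order_def)
qed

text \<open>The term \<open>2 * k\<close> is \<open>- k / 12\<close> times the coefficient - 24 of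
  \<open>E\<^sub>2\<close>.\<close>

lemma serre_fps_nth:
  assumes "\<And>i. i < n \<Longrightarrow> fps_nth F i = 0"
  shows "i < n \<Longrightarrow> fps_nth (serre_fps k F) i = 0"
    and "fps_nth (serre_fps k F) n = (of_nat n - of_int k / 12) * fps_nth F n"
    and "fps_nth (serre_fps k F) (Suc n) =
      (of_nat (Suc n) - of_int k / 12) * fps_nth F (Suc n) + 2 * of_int k * fps_nth F n"
proof -
  have theta: "fps_nth (fps_X * fps_deriv F) i = of_nat i * fps_nth F i" for i
    by (cases i) auto
  have "fps_nth (eisenstein_fps 2 * F) i = 0" if "i < n" for i
    using fps_mult_nth_vanishing(1)[of 0 "eisenstein_fps 2" n F i] that assms by simp
  then show "i < n \<Longrightarrow> fps_nth (serre_fps k F) i = 0"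
    using assms[of i] by (simp add: serre_fps_def theta)
  show "fps_nth (serre_fps k F) n = (of_nat n - of_int k / 12) * fps_nth F n"
    using fps_mult_nth_vanishing(2)[of 0 "eisenstein_fps 2" n F, OF _ assms]
    unfolding serre_fps_def fps_sub_nth theta fps_mult_left_const_nth
    by (simp add: eisenstein_fps_nth_0 algebra_simps)
  have "fps_nth (eisenstein_fps 2 * F) (Suc n) = fps_nth F (Suc n) - 24 * fps_nth F n"
    using fps_mult_nth_Suc_vanishing[of n F "eisenstein_fps 2", OF assms] eisenstein_fps_nth_1(1)
    by (simp add: eisenstein_fps_nth_0)
  then have "fps_nth (serre_fps k F) (Suc n) =
      of_nat (Suc n) * fps_nth F (Suc n) - of_int k / 12 * (fps_nth F (Suc n) - 24 * fps_nth F n)"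
    unfolding serre_fps_def fps_sub_nth theta fps_mult_left_const_nth by simp
  then show "fps_nth (serre_fps k F) (Suc n) =
      (of_nat (Suc n) - of_int k / 12) * fps_nth F (Suc n) + 2 * of_int k * fps_nth F n"
    by (simp add: algebra_simps)
qed

text \<open>The Kaneko--Koike differential equation
  \<open>\<partial>\<^sub>w\<^sub>+\<^sub>1 \<partial>\<^sub>w\<^sub>-\<^sub>1 f = (w\<^sup>2 - 1) / 144 \<cdot> E\<^sub>4 f\<close> holds because both sides have the extremal order
  in weight \<open>w + 4\<close>.\<close>

lemma second_coefficient:
  assumes f: "f \<in> quasimodular_forms1 (int w)" and w: "w = 6 * n"
    and F: "has_q_expansion f F" "\<And>i. i < n \<Longrightarrow> fps_nth F i = 0" "fps_nth F n = 1"
  shows "fps_nth F (Suc n) = 12 * of_nat n * (4 * of_nat n - 1) / (of_nat n + 1)"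
proof -
  let ?S = "serre_fps (int w - 1) F"
  let ?U = "serre_fps (int w + 1) ?S"
  \<comment> \<open>The constant is the product of the factors \<open>n - (w - 1) / 12\<close> and
    \<open>n - (w + 1) / 12\<close> by which the two Serre derivatives multiply the leading
    coefficient, for \<open>w = 6 n\<close>.\<close>
  let ?V = "fps_const ((of_nat w ^ 2 - 1) / 144) * (eisenstein_fps 4 * F)"
  define x where "x = (of_nat n :: complex)"
  define a where "a = fps_nth F (Suc n)"
  have even: "even (int w)" "even (int w + 2)"
    using w by auto
  have S0: "fps_nth ?S i = 0" if "i < n" for i
    using serre_fps_nth(1)[OF F(2)] that by blast
  have Sn: "fps_nth ?S n = (6 * x + 1) / 12"
    using serre_fps_nth(2)[of n F "int w - 1", OF F(2)] F(3) by (simp add: w x_def field_simps)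
  have Sn1: "fps_nth ?S (Suc n) = (6 * x + 13) / 12 * a + 2 * (6 * x - 1)"
    using serre_fps_nth(3)[of n F "int w - 1", OF F(2)] F(3) by (simp add: w x_def a_def field_simps)
  have V0: "fps_nth ?V i = 0" if "i < n" for i
    using fps_mult_nth_vanishing(1)[of 0 "eisenstein_fps 4" n F i] that F by simp
  have Vn: "fps_nth ?V n = (36 * x ^ 2 - 1) / 144"
    using fps_mult_nth_vanishing(2)[of 0 "eisenstein_fps 4" n F] F eisenstein_fps_nth_0
    by (simp add: w x_def power_mult_distrib)
  have Vn1: "fps_nth ?V (Suc n) = (36 * x ^ 2 - 1) / 144 * (a + 240)"
    using fps_mult_nth_Suc_vanishing[of n F "eisenstein_fps 4", OF F(2)] F(3) eisenstein_fps_nth_0[of 4]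
      eisenstein_fps_nth_1(2)
    by (simp add: w x_def a_def power_mult_distrib)
  have U0: "fps_nth ?U i = 0" if "i < n" for i
    using serre_fps_nth(1)[OF S0] that by blast
  have "fps_nth ?U n = (6 * x - 1) / 12 * fps_nth ?S n"
    using serre_fps_nth(2)[of n ?S "int w + 1", OF S0] by (simp add: w x_def field_simps)
  then have Un: "fps_nth ?U n = (36 * x ^ 2 - 1) / 144"
    unfolding Sn by (simp add: field_simps power2_eq_square)
  have "fps_nth ?U (Suc n) = (6 * x + 11) / 12 * fps_nth ?S (Suc n) + 2 * (6 * x + 1) * fps_nth ?S n"
    using serre_fps_nth(3)[of n ?S "int w + 1", OF S0]
    by (simp add: w x_def field_simps)
  then have Un1: "fps_nth ?U (Suc n) =
      (6 * x + 11) / 12 * ((6 * x + 13) / 12 * a + 2 * (6 * x - 1)) + 2 * (6 * x + 1) * ((6 * x + 1) / 12)"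
    unfolding Sn Sn1 .
  let ?u = "serre_deriv (int w + 1) (serre_deriv (int w - 1) f)"
  let ?v = "\<lambda>z. (of_nat w ^ 2 - 1) / 144 * (eisenstein 4 z * f z)"
  have U: "has_q_expansion ?u ?U"
    by (intro serre_q_expansion F(1))
  have V: "has_q_expansion ?v ?V"
    by (intro q_expansion_scale q_expansion_mult eisenstein_q_expansion F(1))
  \<comment> \<open>Since \<open>w + 4 < 6 * Suc n\<close>, agreement up to index \<open>n\<close>
    forces equality, and the coefficient of index \<open>n + 1\<close> then gives a linear equation
    for \<open>a\<close>.\<close>
  have "?u = ?v"
  proof (rule quasimodular_eqI[OF _ _ _ U V, of "w + 4" "Suc n"])
    show "?u \<in> quasimodular_forms1 (int (w + 4))"
      using quasimodular_serre_deriv[OF quasimodular_serre_deriv[OF f even(1)] even(2)] by (simp add: add.commute)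
    show "?v \<in> quasimodular_forms1 (int (w + 4))"
      using quasimodular_mult_modular[OF modular_forms_eisenstein(1) f even(1)] even
      by (intro quasimodular_scale) auto
    show "fps_nth ?U i = fps_nth ?V i" if "i < Suc n" for i
      using that U0 V0 Un Vn by (auto simp: less_Suc_eq)
  qed (use w in auto)
  then have "?U = ?V"
    using U V q_expansion_unique by metis
  then have eq: "(6 * x + 11) / 12 * ((6 * x + 13) / 12 * a + 2 * (6 * x - 1)) + 2 * (6 * x + 1) * ((6 * x + 1) / 12) -
      (36 * x ^ 2 - 1) / 144 * (a + 240) = 0" (is "?lhs = 0")
    using Un1 Vn1 by (metis right_minus_eq)
  have "?lhs = a * (x + 1) - 12 * x * (4 * x - 1)"
    by (simp add: field_simps power2_eq_square)
  then have "a * (x + 1) = 12 * x * (4 * x - 1)"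
    using eq by (metis right_minus_eq)
  moreover have "x + 1 \<noteq> 0"
    unfolding x_def by (metis of_nat_Suc of_nat_eq_0_iff nat.distinct(1) add.commute)
  ultimately show ?thesis
    by (simp add: a_def x_def eq_divide_eq)
qed

text \<open>The leading coefficient of the Serre derivative is \<open>(w + 1) / 12\<close>, hence
  the normalization in weight \<open>w + 2\<close>. In weight \<open>w + 6\<close> both summands
  have order \<open>n\<close>, and their leading terms cancel.\<close>

lemma extremal_step:
  assumes f: "leading_order w n f" and w: "w = 6 * n"
  shows "leading_order (w + 6) (n + 1) (\<lambda>z. of_nat (w + 6) / of_nat (72 * (w + 1) * (w + 5)) *
      (eisenstein 4 z * serre_deriv (int w - 1) f z - of_nat (w + 1) / 12 * eisenstein 6 z * f z))"
    and "leading_order (w + 2) n (\<lambda>z. 12 / of_nat (w + 1) * serre_deriv (int w - 1) f z)"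
proof -
  obtain F where qm: "f \<in> quasimodular_forms1 (int w)"
    and F: "has_q_expansion f F" "\<And>i. i < n \<Longrightarrow> fps_nth F i = 0" "fps_nth F n = 1"
    using f by (auto simp: leading_order_def)
  let ?S = "serre_fps (int w - 1) F"
  define x where "x = (of_nat n :: complex)"
  define a where "a = fps_nth F (Suc n)"
  have x: "x + 1 \<noteq> 0" "6 * x + 1 \<noteq> 0" "6 * x + 5 \<noteq> 0"
  proof -
    have "of_nat (n + 1) \<noteq> (0::complex)" "of_nat (6 * n + 1) \<noteq> (0::complex)" "of_nat (6 * n + 5) \<noteq> (0::complex)"
      unfolding of_nat_eq_0_iff by simp_all
    then show "x + 1 \<noteq> 0" "6 * x + 1 \<noteq> 0" "6 * x + 5 \<noteq> 0"
      by (simp_all add: x_def add.commute)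
  qed
  have a: "a = 12 * x * (4 * x - 1) / (x + 1)"
    using second_coefficient[OF qm w F] by (simp add: a_def x_def)
  have even: "even (int w)" "even (int w + 2)"
    using w by auto
  have S0: "fps_nth ?S i = 0" if "i < n" for i
    using serre_fps_nth(1)[OF F(2)] that by blast
  have Sn: "fps_nth ?S n = (6 * x + 1) / 12"
    using serre_fps_nth(2)[of n F "int w - 1", OF F(2)] F(3) by (simp add: w x_def field_simps)
  have Sn1: "fps_nth ?S (Suc n) = (6 * x + 13) / 12 * a + 2 * (6 * x - 1)"
    using serre_fps_nth(3)[of n F "int w - 1", OF F(2)] F(3) by (simp add: w x_def a_def field_simps)
  have S_qm: "serre_deriv (int w - 1) f \<in> quasimodular_forms1 (int w + 2)"
    using quasimodular_serre_deriv[OF qm even(1)] .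
  have S: "has_q_expansion (serre_deriv (int w - 1) f) ?S"
    by (rule serre_q_expansion[OF F(1)])
  show "leading_order (w + 2) n (\<lambda>z. 12 / of_nat (w + 1) * serre_deriv (int w - 1) f z)"
    unfolding leading_order_def
  proof (intro conjI exI)
    show "(\<lambda>z. 12 / of_nat (w + 1) * serre_deriv (int w - 1) f z) \<in> quasimodular_forms1 (int (w + 2))"
      using S_qm w by (intro quasimodular_scale) (auto simp: add.commute)
    show "has_q_expansion (\<lambda>z. 12 / of_nat (w + 1) * serre_deriv (int w - 1) f z)
        (fps_const (12 / of_nat (w + 1)) * ?S)"
      by (intro q_expansion_scale S)
    have "of_nat (w + 1) = 6 * x + 1"
      by (simp add: w x_def)
    moreover have "12 / c * (c / 12) = 1" if "c \<noteq> 0" for c :: complex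
      using that by simp
    ultimately show "fps_nth (fps_const (12 / of_nat (w + 1)) * ?S) n = 1"
      unfolding fps_mult_left_const_nth Sn using x(2) by metis
  qed (simp add: S0)
  let ?G = "eisenstein_fps 4 * ?S - fps_const (of_nat (w + 1) / 12) * (eisenstein_fps 6 * F)"
  let ?c = "of_nat (w + 6) / of_nat (72 * (w + 1) * (w + 5)) :: complex"
  let ?g = "\<lambda>z. eisenstein 4 z * serre_deriv (int w - 1) f z - of_nat (w + 1) / 12 * (eisenstein 6 z * f z)"
  have eis: "fps_nth (eisenstein_fps k * F) n = 1" "fps_nth (eisenstein_fps k * ?S) n = (6 * x + 1) / 12" for k
    using fps_mult_nth_vanishing(2)[of 0 "eisenstein_fps k" n F] fps_mult_nth_vanishing(2)[of 0 "eisenstein_fps k" n ?S]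
      F S0 Sn eisenstein_fps_nth_0[of k] by simp_all
  have eis_low: "fps_nth (eisenstein_fps k * F) i = 0" "fps_nth (eisenstein_fps k * ?S) i = 0" if "i < n" for k i
    using fps_mult_nth_vanishing(1)[of 0 "eisenstein_fps k" n F] fps_mult_nth_vanishing(1)[of 0 "eisenstein_fps k" n ?S]
      F S0 that by simp_all
  have G0: "fps_nth ?G i = 0" if "i < n + 1" for i
    using that eis eis_low by (auto simp: less_Suc_eq w x_def)
  have E4_S: "fps_nth (eisenstein_fps 4 * ?S) (Suc n) = fps_nth ?S (Suc n) + 240 * fps_nth ?S n"
    using fps_mult_nth_Suc_vanishing[of n ?S "eisenstein_fps 4", OF S0] eisenstein_fps_nth_1(2)
    by (simp add: eisenstein_fps_nth_0)
  have E6_F: "fps_nth (eisenstein_fps 6 * F) (Suc n) = a - 504"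
    using fps_mult_nth_Suc_vanishing[of n F "eisenstein_fps 6", OF F(2)] F(3) eisenstein_fps_nth_1(3)
    by (simp add: eisenstein_fps_nth_0 a_def)
  \<comment> \<open>The new leading coefficient involves \<open>a\<close>; with its value from
    \<open>second_coefficient\<close> it becomes the reciprocal of \<open>?c\<close>.\<close>
  have "fps_nth ?G (Suc n) = fps_nth ?S (Suc n) + 240 * fps_nth ?S n - (6 * x + 1) / 12 * (a - 504)"
    unfolding fps_sub_nth fps_mult_left_const_nth E4_S E6_F by (simp add: w x_def)
  also have "\<dots> = 72 * (6 * x + 1) * (6 * x + 5) / (6 * x + 6)"
  proof -
    \<comment> \<open>After clearing denominators \<open>y\<close> is the only one left, and the
      claim is a polynomial identity.\<close>
    define y where "y = x + 1"
    have y: "y \<noteq> 0" "6 * x + 6 = 6 * y" "x = y - 1"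
      using x(1) by (simp_all add: y_def)
    show ?thesis
      unfolding Sn Sn1 a y_def[symmetric] y(2) using y(1)
      by (simp add: divide_simps) (simp add: y(3) algebra_simps)
  qed
  finally have "?c * fps_nth ?G (Suc n) = (6 * x + 6) / (72 * (6 * x + 1) * (6 * x + 5)) *
      (72 * (6 * x + 1) * (6 * x + 5) / (6 * x + 6))"
    by (simp add: w x_def add_ac)
  also have "\<dots> = 1"
  proof -
    have "6 * x + 6 = 6 * (x + 1)"
      by simp
    then have "6 * x + 6 \<noteq> 0" "72 * (6 * x + 1) * (6 * x + 5) \<noteq> 0"
      using x by (simp_all only: mult_eq_0_iff) simp_all
    moreover have "p / d * (d / p) = 1" if "p \<noteq> 0" "d \<noteq> 0" for p d :: complex
      using that by simp
    ultimately show ?thesis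
      by blast
  qed
  finally have G1: "?c * fps_nth ?G (Suc n) = 1" .
  have "leading_order (w + 6) (n + 1) (\<lambda>z. ?c * ?g z)"
    unfolding leading_order_def
  proof (intro conjI exI)
    have "?g \<in> quasimodular_forms1 (int w + 6)"
      using quasimodular_mult_modular[OF modular_forms_eisenstein(1) S_qm even(2)]
        quasimodular_mult_modular[OF modular_forms_eisenstein(2) qm even(1)] even
      by (intro quasimodular_diff quasimodular_scale) (auto simp: add.commute)
    then show "(\<lambda>z. ?c * ?g z) \<in> quasimodular_forms1 (int (w + 6))"
      using even by (intro quasimodular_scale) auto
    show "has_q_expansion (\<lambda>z. ?c * ?g z) (fps_const ?c * ?G)"
      by (intro q_expansion_scale q_expansion_diff q_expansion_mult eisenstein_q_expansion S F(1))
    show "\<forall>i<n + 1. fps_nth (fps_const ?c * ?G) i = 0"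
      using G0 by simp
    show "fps_nth (fps_const ?c * ?G) (n + 1) = 1"
      using G1 by simp
  qed
  then show "leading_order (w + 6) (n + 1) (\<lambda>z. of_nat (w + 6) / of_nat (72 * (w + 1) * (w + 5)) *
      (eisenstein 4 z * serre_deriv (int w - 1) f z - of_nat (w + 1) / 12 * eisenstein 6 z * f z))"
    by (simp only: mult.assoc)
qed

section \<open>Existence of forms of every admissible order\<close>

lemma leading_order_6:
  "leading_order 6 1 (\<lambda>z. 1 / 720 * (eisenstein 2 z * eisenstein 4 z - eisenstein 6 z))"
  unfolding leading_order_def
proof (intro conjI exI)
  let ?F = "fps_const (1 / 720) * (eisenstein_fps 2 * eisenstein_fps 4 - eisenstein_fps 6)"
  show "has_q_expansion (\<lambda>z. 1 / 720 * (eisenstein 2 z * eisenstein 4 z - eisenstein 6 z)) ?F"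
    by (intro q_expansion_scale q_expansion_diff q_expansion_mult eisenstein_q_expansion)
  show "\<forall>i<1. fps_nth ?F i = 0"
    by (simp add: eisenstein_fps_nth_0)
  \<comment> \<open>The coefficients of \<open>q\<close> give
    \<open>- 24 + 240 + 504 = 720\<close>.\<close>
  show "fps_nth ?F 1 = 1"
    using eisenstein_fps_nth_1 by (simp add: fps_mult_nth eisenstein_fps_nth_0)
  show "(\<lambda>z. 1 / 720 * (eisenstein 2 z * eisenstein 4 z - eisenstein 6 z)) \<in> quasimodular_forms1 (int 6)"
    unfolding quasimodular_forms1_iff
    by (intro bexI[of _ "\<lambda>z. (- 1 / 720) * eisenstein 6 z"] bexI[of _ "\<lambda>z. 1 / 720 * eisenstein 4 z"]
        modular_forms_scale) (auto simp: modular_forms_eisenstein algebra_simps)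
qed

text \<open>The recursion for weight \<open>w + 6\<close> also works from weight 0, where the
  extremal form is the constant 1.\<close>

lemma leading_order_extremal_exists: "\<exists>f. leading_order (6 * n) n f"
proof (induction n)
  case 0
  let ?f = "\<lambda>z. if z \<in> upper_half_plane then 1 else 0 :: complex"
  have "?f \<in> quasimodular_forms1 (int 0)"
    using modular_forms_one modular_forms_zero[of "- 2"]
    by (intro quasimodular_forms1I[of ?f _ "\<lambda>z. 0"]) simp_all
  moreover have "has_q_expansion ?f (fps_const 1)"
    by (rule q_expansion_cong[OF q_expansion_const]) simp
  ultimately show ?case
    unfolding leading_order_def by (intro exI[of _ ?f] conjI exI[of _ "fps_const 1"]) simp_all
next
  case (Suc n)
  then obtain f where "leading_order (6 * n) n f"
    by blast
  then have "\<exists>g. leading_order (6 * n + 6) (n + 1) g"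
    by (intro exI) (rule extremal_step(1)[OF _ refl])
  then show ?case
    by (simp add: add.commute)
qed

text \<open>Every even weight except 2 is of the form \<open>4 a + 6 b\<close>.\<close>

lemma leading_order_add_weight:
  assumes "leading_order w n f" "even w" "even k" "k \<noteq> 2"
  shows "\<exists>g. leading_order (w + k) n g"
  using assms(3,4)
proof (induction k rule: less_induct)
  case (less k)
  consider "k = 0" | "k = 6" | "k \<ge> 4" "k \<noteq> 6"
  proof -
    have "k = 0 \<or> k = 6 \<or> k \<ge> 4 \<and> k \<noteq> 6"
      using less.prems by presburger
    then show ?thesis
      using that by blast
  qed
  then show ?case
  proof cases
    case 2
    then show ?thesis
      using eisenstein_mult_leading_order[OF assms(1,2), of 6] by auto
  next
    case 3
    then have "k - 4 < k" "even (k - 4)" "k - 4 \<noteq> 2"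
      using less.prems by auto
    then obtain g where "leading_order (w + (k - 4)) n g"
      using less.IH by blast
    from eisenstein_mult_leading_order[OF this, of 4] have
      "leading_order (w + (k - 4) + 4) n (\<lambda>z. eisenstein 4 z * g z)"
      using assms(2) less.prems by simp
    moreover have "w + (k - 4) + 4 = w + k"
      using 3 by simp
    ultimately show ?thesis
      by metis
  qed (use assms in auto)
qed

text \<open>Start from the extremal form of weight \<open>6 * i\<close> and raise the weight by
  products with \<open>E\<^sub>4\<close> and \<open>E\<^sub>6\<close>. A gap of 2 is out of their
  reach and is closed by the Serre derivative.\<close>

lemma leading_order_exists:
  assumes "even w" "i \<le> w div 6"
  shows "\<exists>f. leading_order w i f"
proof -
  obtain f where f: "leading_order (6 * i) i f"
    using leading_order_extremal_exists by blast
  have w: "w = 6 * i + (w - 6 * i)"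
    using assms(2) by linarith
  show ?thesis
  proof (cases "w - 6 * i = 2")
    case True
    with w extremal_step(2)[OF f refl] show ?thesis
      by metis
  next
    case False
    then show ?thesis
      using leading_order_add_weight[OF f, of "w - 6 * i"] w assms(1) by auto
  qed
qed

section \<open>The dimension in depth 1\<close>

definition vanishing_forms :: "nat \<Rightarrow> (complex \<Rightarrow> complex) set" where
  "vanishing_forms m = {f. \<exists>F. has_q_expansion f F \<and> (\<forall>i<m. fps_nth F i = 0)}"

lemma subspace_vanishing_forms: "cfun.subspace (vanishing_forms m)"
proof (rule cfun.subspaceI)
  show "0 \<in> vanishing_forms m"
    using q_expansion_const[of 0] by (auto simp: vanishing_forms_def zero_fun_def intro!: exI[of _ 0])
next
  fix f g assume "f \<in> vanishing_forms m" "g \<in> vanishing_forms m"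
  then obtain F G where "has_q_expansion f F" "has_q_expansion g G"
    "\<forall>i<m. fps_nth F i = 0" "\<forall>i<m. fps_nth G i = 0"
    by (auto simp: vanishing_forms_def)
  then show "f + g \<in> vanishing_forms m"
    using q_expansion_add[of f F g G] by (auto simp: vanishing_forms_def plus_fun_def intro!: exI[of _ "F + G"])
next
  fix c f assume "f \<in> vanishing_forms m"
  then obtain F where "has_q_expansion f F" "\<forall>i<m. fps_nth F i = 0"
    by (auto simp: vanishing_forms_def)
  then show "cfun_scale c f \<in> vanishing_forms m"
    using q_expansion_scale[of f F c]
    by (auto simp: vanishing_forms_def cfun_scale_def intro!: exI[of _ "fps_const c * F"])
qed

text \<open>Forms with leading term \<open>q ^ i\<close> for each \<open>i \<le> w div 6\<close> are
  a triangular basis for the filtration by order at the cusp.\<close>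

theorem dim_quasimodular_forms1:
  assumes w: "even w"
  shows "cfun.dim (quasimodular_forms1 (int w)) = Suc (w div 6)"
proof -
  define N where "N = w div 6"
  have "\<forall>i\<in>{..N}. \<exists>f. leading_order w i f"
    using leading_order_exists[OF w] by (simp add: N_def)
  then obtain e where e: "\<And>i. i \<le> N \<Longrightarrow> leading_order w i (e i)"
    by (metis atMost_iff)
  have e_vanishing: "e i \<in> vanishing_forms m \<longleftrightarrow> m \<le> i" if "i \<le> N" for i m
  proof -
    obtain F where F: "has_q_expansion (e i) F" "\<forall>j<i. fps_nth F j = 0" "fps_nth F i = 1"
      using e[OF \<open>i \<le> N\<close>] by (auto simp: leading_order_def)
    show ?thesis
    proof
      assume "e i \<in> vanishing_forms m"
      then have "\<forall>j<m. fps_nth F j = 0"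
        using q_expansion_unique[OF F(1)] by (auto simp: vanishing_forms_def)
      with F(3) show "m \<le> i"
        by (metis not_le zero_neq_one)
    qed (use F in \<open>auto simp: vanishing_forms_def\<close>)
  qed
  have "inj_on e {..N}"
  proof (rule inj_onI)
    fix i j assume ij: "i \<in> {..N}" "j \<in> {..N}" "e i = e j"
    have "i \<le> j" "j \<le> i"
      using e_vanishing[of i i] e_vanishing[of i j] e_vanishing[of j i] e_vanishing[of j j] ij(1,2)
      unfolding ij(3) by blast+
    then show "i = j"
      by simp
  qed
  then have card: "card (e ` {..N}) = Suc (w div 6)"
    by (simp add: card_image N_def)
  \<comment> \<open>Downward induction: all combinations of the later forms vanish to order
    \<open>Suc i\<close>, while \<open>e i\<close> does not.\<close>
  have indep: "cfun.independent (e ` {i..N})" if "i \<le> Suc N" for i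
    using that
  proof (induction i rule: inc_induct)
    case base
    show ?case
      by (simp add: cfun.independent_empty)
  next
    case (step i)
    then have i: "i \<le> N"
      by simp
    have "e ` {Suc i..N} \<subseteq> vanishing_forms (Suc i)"
      using e_vanishing by auto
    then have "cfun.span (e ` {Suc i..N}) \<subseteq> vanishing_forms (Suc i)"
      using subspace_vanishing_forms by (rule cfun.span_minimal)
    then have "e i \<notin> cfun.span (e ` {Suc i..N})"
      using e_vanishing[OF i, of "Suc i"] by auto
    then have "cfun.independent (insert (e i) (e ` {Suc i..N}))"
      using step.IH by (rule cfun.independent_insertI)
    also have "insert (e i) (e ` {Suc i..N}) = e ` {i..N}"
      using i by (simp add: atLeastAtMost_insertL[symmetric])
    finally show ?case .
  qed
  \<comment> \<open>Gaussian elimination, run as downward induction: subtracting a multiple of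
    \<open>e i\<close> raises the order, and beyond order \<open>N\<close> the vanishing criterion
    leaves only 0.\<close>
  have span: "f \<in> cfun.span (e ` {..N})"
    if "i \<le> Suc N" "f \<in> quasimodular_forms1 (int w)" "has_q_expansion f F" "\<forall>j<i. fps_nth F j = 0" for i f F
    using that
  proof (induction i arbitrary: f F rule: inc_induct)
    case base
    then have "f = (\<lambda>z. 0)"
      by (intro quasimodular_vanishes[OF _ w, of f F "Suc N"]) (auto simp: N_def)
    then show ?case
      using cfun.span_zero by (simp add: zero_fun_def)
  next
    case (step i)
    obtain E where E: "e i \<in> quasimodular_forms1 (int w)" "has_q_expansion (e i) E"
      "\<forall>j<i. fps_nth E j = 0" "fps_nth E i = 1"
      using e[of i] step.hyps by (auto simp: leading_order_def)
    define c where "c = fps_nth F i"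
    have "(\<lambda>z. f z - c * e i z) \<in> cfun.span (e ` {..N})"
    proof (rule step.IH)
      show "(\<lambda>z. f z - c * e i z) \<in> quasimodular_forms1 (int w)"
        using step.prems E w by (intro quasimodular_diff quasimodular_scale) auto
      show "has_q_expansion (\<lambda>z. f z - c * e i z) (F - fps_const c * E)"
        using step.prems E by (intro q_expansion_diff q_expansion_scale) auto
      show "\<forall>j<Suc i. fps_nth (F - fps_const c * E) j = 0"
        using step.prems E by (auto simp: less_Suc_eq c_def)
    qed
    moreover have "cfun_scale c (e i) \<in> cfun.span (e ` {..N})"
      using step.hyps by (intro cfun.span_scale cfun.span_base) auto
    ultimately have "(\<lambda>z. f z - c * e i z) + cfun_scale c (e i) \<in> cfun.span (e ` {..N})"
      by (rule cfun.span_add)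
    also have "(\<lambda>z. f z - c * e i z) + cfun_scale c (e i) = f"
      by (simp add: fun_eq_iff cfun_scale_def)
    finally show ?case .
  qed
  show ?thesis
  proof (rule cfun.dim_unique[OF _ _ _ card])
    show "e ` {..N} \<subseteq> quasimodular_forms1 (int w)"
      using e by (auto simp: leading_order_def)
    show "quasimodular_forms1 (int w) \<subseteq> cfun.span (e ` {..N})"
    proof
      fix f assume f: "f \<in> quasimodular_forms1 (int w)"
      then obtain F where "has_q_expansion f F"
        by (rule quasimodular_q_expansion)
      from span[of 0, OF _ f this] show "f \<in> cfun.span (e ` {..N})"
        by simp
    qed
    show "cfun.independent (e ` {..N})"
      using indep[of 0] by (simp add: atMost_atLeast0)
  qed
qed

section \<open>From extremal forms to the recursions\<close>

lemma normalized_extremal1_imp_leading_order: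
  assumes "normalized_extremal1 (int w) f" "even w"
  shows "leading_order w (w div 6) f"
proof -
  obtain F where F: "f \<in> quasimodular_forms1 (int w)" "has_q_expansion f F"
    "subdegree F = w div 6" "fps_nth F (subdegree F) = 1"
    using assms dim_quasimodular_forms1[OF assms(2)] by (auto simp: normalized_extremal1_def)
  have "fps_nth F i = 0" if "i < w div 6" for i
    using that F(3) by (intro nth_less_subdegree_zero) simp
  with F show ?thesis
    unfolding leading_order_def by metis
qed

theorem proposition6p1:
  fixes f :: "nat \<Rightarrow> complex \<Rightarrow> complex"
  assumes extremal: "\<And>w. even w \<Longrightarrow> w \<ge> 6 \<Longrightarrow> normalized_extremal1 (int w) (f w)"
  shows "(\<forall>z\<in>upper_half_plane.
            f 6 z = 1 / 720 * (eisenstein 2 z * eisenstein 4 z - eisenstein 6 z)) \<and>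
         (\<forall>w\<ge>6. w mod 6 = 0 \<longrightarrow> (\<forall>z\<in>upper_half_plane.
            f (w + 6) z =
              of_nat (w + 6) / of_nat (72 * (w + 1) * (w + 5)) *
                (eisenstein 4 z * serre_deriv (int w - 1) (f w) z
                   - of_nat (w + 1) / 12 * eisenstein 6 z * f w z) \<and>
            f (w + 2) z = 12 / of_nat (w + 1) * serre_deriv (int w - 1) (f w) z \<and>
            f (w + 4) z = eisenstein 4 z * f w z))"
proof (rule conjI)
  have lead: "leading_order w (w div 6) (f w)" if "even w" "w \<ge> 6" for w
    using normalized_extremal1_imp_leading_order[OF extremal] that by blast
  show "\<forall>z\<in>upper_half_plane. f 6 z = 1 / 720 * (eisenstein 2 z * eisenstein 4 z - eisenstein 6 z)"
  proof -
    have "leading_order 6 1 (f 6)"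
      using lead[of 6] by simp
    from leading_order_unique[OF this leading_order_6]
    have "f 6 = (\<lambda>z. 1 / 720 * (eisenstein 2 z * eisenstein 4 z - eisenstein 6 z))"
      by (rule) simp_all
    then show ?thesis
      by metis
  qed
  show "\<forall>w\<ge>6. w mod 6 = 0 \<longrightarrow> (\<forall>z\<in>upper_half_plane.
            f (w + 6) z =
              of_nat (w + 6) / of_nat (72 * (w + 1) * (w + 5)) *
                (eisenstein 4 z * serre_deriv (int w - 1) (f w) z
                   - of_nat (w + 1) / 12 * eisenstein 6 z * f w z) \<and>
            f (w + 2) z = 12 / of_nat (w + 1) * serre_deriv (int w - 1) (f w) z \<and>
            f (w + 4) z = eisenstein 4 z * f w z)"
  proof (intro allI impI)
    fix w :: nat assume w6: "w \<ge> 6" "w mod 6 = 0"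
    define n where "n = w div 6"
    have w: "w = 6 * n"
      unfolding n_def using w6(2) by presburger
    have even: "even w"
      by (simp add: w)
    have "leading_order w n (f w)"
      using lead[OF even w6(1)] by (simp add: n_def)
    note step = extremal_step[OF this w] eisenstein_mult_leading_order[OF this even, of 4]
    \<comment> \<open>Weights \<open>w\<close>, \<open>w + 2\<close> and \<open>w + 4\<close> share
      the extremal order \<open>n\<close>; it rises by one in weight \<open>w + 6\<close>
      only.\<close>
    have div: "(w + 6) div 6 = n + 1" "(w + 2) div 6 = n" "(w + 4) div 6 = n"
      unfolding w by linarith+
    have evens: "even (w + 6)" "even (w + 2)" "even (w + 4)"
      using even by simp_all
    have bounds: "w + 6 < 6 * Suc (n + 1)" "w + 2 < 6 * Suc n" "w + 4 < 6 * Suc n"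
      by (simp_all add: w)
    have leads: "leading_order (w + 6) (n + 1) (f (w + 6))" "leading_order (w + 2) n (f (w + 2))"
      "leading_order (w + 4) n (f (w + 4))"
      using lead[OF evens(1)] lead[OF evens(2)] lead[OF evens(3)] w6(1) unfolding div by simp_all
    have step_4: "leading_order (w + 4) n (\<lambda>z. eisenstein 4 z * f w z)"
      using step(3) by simp
    note eqs = leading_order_unique[OF leads(1) step(1) evens(1) bounds(1)]
      leading_order_unique[OF leads(2) step(2) evens(2) bounds(2)]
      leading_order_unique[OF leads(3) step_4 evens(3) bounds(3)]
    show "\<forall>z\<in>upper_half_plane.
            f (w + 6) z =
              of_nat (w + 6) / of_nat (72 * (w + 1) * (w + 5)) *
                (eisenstein 4 z * serre_deriv (int w - 1) (f w) z
                   - of_nat (w + 1) / 12 * eisenstein 6 z * f w z) \<and>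
            f (w + 2) z = 12 / of_nat (w + 1) * serre_deriv (int w - 1) (f w) z \<and>
            f (w + 4) z = eisenstein 4 z * f w z"
    proof (intro ballI conjI)
      fix z :: complex
      show "f (w + 6) z = of_nat (w + 6) / of_nat (72 * (w + 1) * (w + 5)) *
                (eisenstein 4 z * serre_deriv (int w - 1) (f w) z
                   - of_nat (w + 1) / 12 * eisenstein 6 z * f w z)"
        by (rule fun_cong[OF eqs(1)])
      show "f (w + 2) z = 12 / of_nat (w + 1) * serre_deriv (int w - 1) (f w) z"
        by (rule fun_cong[OF eqs(2)])
      show "f (w + 4) z = eisenstein 4 z * f w z"
        by (rule fun_cong[OF eqs(3)])
    qed
  qed
qed

end
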